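(* Let $t\in[0,1)$ and $p\in\{0\}\cup(1,\infty)$. The operator $\mathcal{C}_t\in\mathcal{L}(ces_p)$ satisfies $\|\mathcal{C}_t\|_{ces_p\to ces_p}\le(1-t)^{-1}$, is compact and has spectrum $\sigma(\mathcal{C}_t;ces_p)=\Lambda\cup\{0\}$. Moreover, the fine spectra of $\mathcal{C}_t$ are given by $$\sigma_{\mathrm p}(\mathcal{C}_t;ces_p)=\Lambda,\quad \sigma_{\mathrm c}(\mathcal{C}_t;ces_p)=\{0\},\quad \sigma_{\mathrm r}(\mathcal{C}_t;ces_p)=\emptyset.$$
   Context: Let $\mathbb{N}_0=\{0,1,2,\dots\}$ and $\Lambda:=\{1/(n+1):n\in\mathbb{N}_0\}$. For $t\in[0,1]$ the generalized Cesàro operator on $\mathbb{C}^{\mathbb{N}_0}$ is $(\mathcal{C}_tx)_n=\frac{1}{n+1}\sum_{k=0}^n t^{n-k}x_k$ (with $0^0=1$); in particular $(\mathcal{C}_1x)_n=\frac1{n+1}\sum_{k=0}^nx_k$. $\mathcal{C}_t\in\mathcal{L}(X)$ means that it maps $X$ continuously into itself; the restriction is also denoted $\mathcal{C}_t$. For $x\in\mathbb{C}^{\mathbb{N}_0}$ put $|x|=(|x_n|)_n$. For $1<p<\infty$, $ces_p:=\{x\in\mathbb{C}^{\mathbb{N}_0}:\mathcal{C}_1|x|\in\ell^p\}$ with norm $\|x\|_{ces_p}:=\|\mathcal{C}_1|x|\|_p$ (the $\ell^p$-norm). $ces_0:=\{x\in\mathbb{C}^{\mathbb{N}_0}:\mathcal{C}_1|x|\in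 c_0\}$ with norm $\|x\|_{ces_0}:=\|\mathcal{C}_1|x|\|_\infty$. These are Banach spaces. $\mathcal{L}(X)$ is the space of continuous linear operators on $X$. For $T\in\mathcal{L}(X)$: $\sigma(T;X)$ is the set of $\lambda\in\mathbb{C}$ with $T-\lambda I$ not invertible in $\mathcal{L}(X)$; $\sigma_{\mathrm p}(T;X)$ is the set of $\lambda$ with $T-\lambda I$ not injective; $\sigma_{\mathrm c}(T;X)$ is the set of $\lambda$ with $T-\lambda I$ injective and range a proper dense subspace of $X$; $\sigma_{\mathrm r}(T;X)$ is the set of $\lambda$ with $T-\lambda I$ injective and range not dense in $X$. *)

theory Defs
  imports "HOL-Analysis.Analysis"
begin

type_synonym cseq = "nat \<Rightarrow> complex"

section \<open>Operators on normed spaces of complex sequences\<close>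

text \<open>
  A normed sequence space is given by its carrier \<open>X\<close> and a norm \<open>N\<close>, whose values
  outside \<open>X\<close> are irrelevant. An operator is a function on all sequences of which
  only the restriction to \<open>X\<close> matters.
\<close>

text \<open>
  The distance is set to 0 off \<open>X\<close> because the locale \<open>Metric_space\<close> asks for
  nonnegativity and symmetry on the whole type, not just on the carrier.
\<close>

definition seq_dist :: "cseq set \<Rightarrow> (cseq \<Rightarrow> real) \<Rightarrow> cseq \<Rightarrow> cseq \<Rightarrow> real" where
  "seq_dist X N x y = (if x \<in> X \<and> y \<in> X then N (\<lambda>n. x n - y n) else 0)"

definition norm_top :: "cseq set \<Rightarrow> (cseq \<Rightarrow> real) \<Rightarrow> cseq topology" where
  "norm_top X N = Metric_space.mtopology X (seq_dist X N)"

definition linear_ops :: "cseq set \<Rightarrow> (cseq \<Rightarrow> cseq) set" where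
  "linear_ops X = {T. (\<forall>x\<in>X. T x \<in> X) \<and>
     (\<forall>x\<in>X. \<forall>y\<in>X. T (\<lambda>n. x n + y n) = (\<lambda>n. T x n + T y n)) \<and>
     (\<forall>c. \<forall>x\<in>X. T (\<lambda>n. c * x n) = (\<lambda>n. c * T x n))}"

definition cont_linear_ops :: "cseq set \<Rightarrow> (cseq \<Rightarrow> real) \<Rightarrow> (cseq \<Rightarrow> cseq) set" where
  "cont_linear_ops X N =
     {T \<in> linear_ops X. continuous_map (norm_top X N) (norm_top X N) T}"

text \<open>Meaningful only for operators in \<open>cont_linear_ops X N\<close>, where the supremum is finite.\<close>

definition op_norm :: "cseq set \<Rightarrow> (cseq \<Rightarrow> real) \<Rightarrow> (cseq \<Rightarrow> cseq) \<Rightarrow> real" where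
  "op_norm X N T = (SUP x\<in>{x \<in> X. N x \<le> 1}. N (T x))"

definition compact_op :: "cseq set \<Rightarrow> (cseq \<Rightarrow> real) \<Rightarrow> (cseq \<Rightarrow> cseq) \<Rightarrow> bool" where
  "compact_op X N T \<longleftrightarrow> T \<in> cont_linear_ops X N \<and>
     compactin (norm_top X N) (norm_top X N closure_of (T ` {x \<in> X. N x \<le> 1}))"

definition invertible_op :: "cseq set \<Rightarrow> (cseq \<Rightarrow> real) \<Rightarrow> (cseq \<Rightarrow> cseq) \<Rightarrow> bool" where
  "invertible_op X N T \<longleftrightarrow> T \<in> cont_linear_ops X N \<and>
     (\<exists>S\<in>cont_linear_ops X N. \<forall>x\<in>X. S (T x) = x \<and> T (S x) = x)"

text \<open>The operator \<open>T - \<lambda>I\<close>.\<close>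

definition shift_op :: "(cseq \<Rightarrow> cseq) \<Rightarrow> complex \<Rightarrow> cseq \<Rightarrow> cseq" where
  "shift_op T l x = (\<lambda>n. T x n - l * x n)"

definition spectrum_op :: "cseq set \<Rightarrow> (cseq \<Rightarrow> real) \<Rightarrow> (cseq \<Rightarrow> cseq) \<Rightarrow> complex set" where
  "spectrum_op X N T = {l. \<not> invertible_op X N (shift_op T l)}"

definition point_spectrum :: "cseq set \<Rightarrow> (cseq \<Rightarrow> cseq) \<Rightarrow> complex set" where
  "point_spectrum X T = {l. \<not> inj_on (shift_op T l) X}"

definition continuous_spectrum ::
    "cseq set \<Rightarrow> (cseq \<Rightarrow> real) \<Rightarrow> (cseq \<Rightarrow> cseq) \<Rightarrow> complex set" where
  "continuous_spectrum X N T = {l. inj_on (shift_op T l) X \<and> shift_op T l ` X \<noteq> X \<and>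
     norm_top X N closure_of (shift_op T l ` X) = X}"

definition residual_spectrum ::
    "cseq set \<Rightarrow> (cseq \<Rightarrow> real) \<Rightarrow> (cseq \<Rightarrow> cseq) \<Rightarrow> complex set" where
  "residual_spectrum X N T = {l. inj_on (shift_op T l) X \<and>
     norm_top X N closure_of (shift_op T l ` X) \<noteq> X}"

section \<open>Generalized Cesaro operators and the spaces \<open>ces\<close>\<close>

definition cesaro :: "real \<Rightarrow> cseq \<Rightarrow> cseq" where
  "cesaro t x n = (1 / of_nat (n + 1)) * (\<Sum>k\<le>n. of_real t ^ (n - k) * x k)"

definition abs_seq :: "cseq \<Rightarrow> cseq" where
  "abs_seq x = (\<lambda>n. of_real (cmod (x n)))"

definition lp_space :: "real \<Rightarrow> cseq set" where
  "lp_space p = {x. summable (\<lambda>n. cmod (x n) powr p)}"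

definition lp_norm :: "real \<Rightarrow> cseq \<Rightarrow> real" where
  "lp_norm p x = (\<Sum>n. cmod (x n) powr p) powr (1 / p)"

definition c0_space :: "cseq set" where
  "c0_space = {x. x \<longlonglongrightarrow> 0}"

definition sup_norm :: "cseq \<Rightarrow> real" where
  "sup_norm x = (SUP n. cmod (x n))"

text \<open>The parameter \<open>p = 0\<close> encodes the space \<open>ces\<^sub>0\<close>, built on \<open>c\<^sub>0\<close>; otherwise \<open>1 < p\<close>.\<close>

definition ces :: "real \<Rightarrow> cseq set" where
  "ces p = {x. cesaro 1 (abs_seq x) \<in> (if p = 0 then c0_space else lp_space p)}"

definition ces_norm :: "real \<Rightarrow> cseq \<Rightarrow> real" where
  "ces_norm p x =
     (if p = 0 then sup_norm (cesaro 1 (abs_seq x)) else lp_norm p (cesaro 1 (abs_seq x)))"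

definition Lam :: "complex set" where
  "Lam = range (\<lambda>n. 1 / of_nat (n + 1))"

end

theory Submission
  imports Defs
begin

text \<open>
  The operator \<open>cesaro t\<close> is \<open>D G\<close>, where \<open>G = \<Sum>\<^sub>j t\<^sup>j S\<^sup>j = (I - t S)\<^sup>-\<^sup>1\<close> is convolution with the
  geometric sequence (\<open>geom_conv t\<close>), \<open>S\<close> is the right shift and \<open>D\<close> multiplies the \<open>n\<close>-th
  coordinate by \<open>1 / (n + 1)\<close>. On a solid space of sequences on which \<open>S\<close> is a contraction, \<open>G\<close> has
  norm at most \<open>1 / (1 - t)\<close> and \<open>D\<close> is a contraction that shrinks the tail from \<open>m\<close> on by the
  factor \<open>1 / (m + 1)\<close>. This gives the norm bound, and it gives compactness because a bounded set with
  uniformly small tails is totally bounded (\<open>mtotally_bounded_if_small_tails\<close>).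
  
  For the spectrum, \<open>D G - \<lambda> I = (D - \<lambda> (I - t S)) G\<close>, so that solving \<open>(D G - \<lambda> I) x = y\<close> amounts to
  solving the two-term recursion \<open>(1 / (n + 1) - \<lambda>) z\<^sub>n + \<lambda> t z\<^sub>n\<^sub>-\<^sub>1 = y\<^sub>n\<close> for \<open>z = G x\<close>. If \<open>\<lambda> \<noteq> 0\<close>
  and \<open>\<lambda>\<close> is not in \<open>Lam\<close>, the ratio of consecutive coefficients tends to \<open>t < 1\<close> in modulus, so
  \<open>\<bar>z\<bar>\<close> is dominated by a multiple of the geometric convolution of \<open>\<bar>y\<bar>\<close> with some ratio \<open>r < 1\<close>, and
  the solution depends boundedly on \<open>y\<close> (\<open>solve_shift_cesaro\<close>). If \<open>\<lambda> = 1 / (m + 1)\<close>, the sequence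
  \<open>binomial(n, m) t\<^sup>n\<^sup>-\<^sup>m\<close> is an eigenvector by the hockey-stick identity. If \<open>\<lambda> = 0\<close>, the operator is
  injective because it is triangular, its range is dense because it contains all finitely supported
  sequences, and it is not onto because a lacunary series yields a member \<open>y\<close> of the space for
  which \<open>(n + 1) y\<^sub>n\<close> is not in the space (\<open>lacunary_not_divisible\<close>).
  
  All of this uses only a few order and shift properties of the space, collected in the locale
  \<open>shift_lattice\<close>. They hold for \<open>\<ell>\<^sup>p\<close> and \<open>c\<^sub>0\<close>, and they pass from a space \<open>Y\<close> to the space of
  all \<open>x\<close> whose sequence of averages of \<open>\<bar>x\<bar>\<close> lies in \<open>Y\<close> (\<open>shift_lattice_average\<close>), that is, to the
  spaces \<open>ces p\<close>.
\<close>

section \<open>Solid sequence spaces with a contractive shift\<close>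

definition unit_seq :: "nat \<Rightarrow> cseq" where
  "unit_seq m n = (if n = m then 1 else 0)"

definition right_shift :: "cseq \<Rightarrow> cseq" where
  "right_shift x n = (case n of 0 \<Rightarrow> 0 | Suc k \<Rightarrow> x k)"

definition restr :: "nat set \<Rightarrow> cseq \<Rightarrow> cseq" where
  "restr A x n = (if n \<in> A then x n else 0)"

text \<open>
  The last axiom replaces completeness: it asks only that a sequence whose truncations form a Cauchy
  sequence belongs to the space. It is easy to verify in concrete spaces, and completeness in norm
  follows from it (lemma \<open>complete\<close> below). A Fatou property, which would ask only for bounded
  truncations, fails in \<open>c\<^sub>0\<close>.
\<close>

locale shift_lattice =
  fixes X :: "cseq set" and N :: "cseq \<Rightarrow> real"
  assumes add: "x \<in> X \<Longrightarrow> y \<in> X \<Longrightarrow> (\<lambda>n. x n + y n) \<in> X"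
    and norm_add: "x \<in> X \<Longrightarrow> y \<in> X \<Longrightarrow> N (\<lambda>n. x n + y n) \<le> N x + N y"
    and scale: "x \<in> X \<Longrightarrow> (\<lambda>n. c * x n) \<in> X"
    and norm_scale: "x \<in> X \<Longrightarrow> N (\<lambda>n. c * x n) = cmod c * N x"
    and solid: "y \<in> X \<Longrightarrow> (\<And>n. cmod (x n) \<le> cmod (y n)) \<Longrightarrow> x \<in> X"
    and norm_solid: "y \<in> X \<Longrightarrow> (\<And>n. cmod (x n) \<le> cmod (y n)) \<Longrightarrow> N x \<le> N y"
    and unit0: "unit_seq 0 \<in> X"
    and shift: "x \<in> X \<Longrightarrow> right_shift x \<in> X"
    and norm_shift: "x \<in> X \<Longrightarrow> N (right_shift x) \<le> N x"
    and coord: "\<exists>K\<ge>0. \<forall>x\<in>X. cmod (x n) \<le> K * N x"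
    and tail: "x \<in> X \<Longrightarrow> (\<lambda>m. N (restr {m..} x)) \<longlonglongrightarrow> 0"
    and Cauchy_truncations:
      "(\<And>\<epsilon>. \<epsilon> > 0 \<Longrightarrow> \<exists>m. \<forall>n. N (restr {m..<n} x) \<le> \<epsilon>) \<Longrightarrow> x \<in> X"
begin

lemma zero: "(\<lambda>n. 0) \<in> X"
  using scale[OF unit0, of 0] by simp

lemma norm_zero: "N (\<lambda>n. 0) = 0"
  using norm_scale[OF unit0, of 0] by simp

lemma norm_nonneg: "x \<in> X \<Longrightarrow> 0 \<le> N x"
  using norm_solid[of x "\<lambda>n. 0"] norm_zero by simp

lemma norm_eq_zero: "x \<in> X \<Longrightarrow> N x = 0 \<Longrightarrow> x = (\<lambda>n. 0)"
proof
  fix n assume "x \<in> X" "N x = 0"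
  then show "x n = 0"
    using coord[of n] by fastforce
qed

lemma diff: "x \<in> X \<Longrightarrow> y \<in> X \<Longrightarrow> (\<lambda>n. x n - y n) \<in> X"
  using add[of x "\<lambda>n. (-1) * y n"] scale[of y "-1"] by simp

lemma norm_diff: "x \<in> X \<Longrightarrow> y \<in> X \<Longrightarrow> N (\<lambda>n. x n - y n) \<le> N x + N y"
  using norm_add[of x "\<lambda>n. (-1) * y n"] scale[of y "-1"] norm_scale[of y "-1"] by simp

lemma norm_diff_commute: "x \<in> X \<Longrightarrow> y \<in> X \<Longrightarrow> N (\<lambda>n. x n - y n) = N (\<lambda>n. y n - x n)"
  using norm_scale[OF diff[of x y], of "-1"] by simp

lemma norm_diff_triangle:
  assumes "x \<in> X" "y \<in> X" "z \<in> X"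
  shows "N (\<lambda>n. x n - z n) \<le> N (\<lambda>n. x n - y n) + N (\<lambda>n. y n - z n)"
  using norm_add[OF diff[of x y] diff[of y z]] assms by simp

lemma sum_mem: "(\<And>i. i \<in> I \<Longrightarrow> f i \<in> X) \<Longrightarrow> (\<lambda>n. \<Sum>i\<in>I. f i n) \<in> X"
  by (induction I rule: infinite_finite_induct) (auto simp: zero intro!: add)

lemma norm_sum: "(\<And>i. i \<in> I \<Longrightarrow> f i \<in> X) \<Longrightarrow> N (\<lambda>n. \<Sum>i\<in>I. f i n) \<le> (\<Sum>i\<in>I. N (f i))"
proof (induction I rule: infinite_finite_induct)
  case (insert i I)
  then have "N (\<lambda>n. f i n + (\<Sum>i\<in>I. f i n)) \<le> N (f i) + N (\<lambda>n. \<Sum>i\<in>I. f i n)"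
    by (intro norm_add sum_mem) auto
  with insert show ?case by simp
qed (auto simp: norm_zero)

lemma restr_mem: "x \<in> X \<Longrightarrow> restr A x \<in> X"
  by (rule solid[of x]) (auto simp: restr_def)

lemma norm_restr: "x \<in> X \<Longrightarrow> N (restr A x) \<le> N x"
  by (rule norm_solid[of x]) (auto simp: restr_def)

lemma unit_mem: "unit_seq n \<in> X"
proof (induction n)
  case (Suc n)
  have "right_shift (unit_seq n) = unit_seq (Suc n)"
    by (auto simp: right_shift_def unit_seq_def fun_eq_iff split: nat.split)
  then show ?case using shift[OF Suc] by simp
qed (rule unit0)

lemma norm_unit_pos: "0 < N (unit_seq n)"
proof -
  have "unit_seq n \<noteq> (\<lambda>n. 0)" by (auto simp: unit_seq_def fun_eq_iff)
  then show ?thesis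
    using norm_eq_zero[OF unit_mem] norm_nonneg[OF unit_mem] by (metis less_eq_real_def)
qed

lemma restr_finite_eq: "finite A \<Longrightarrow> restr A x = (\<lambda>n. \<Sum>i\<in>A. x i * unit_seq i n)"
  by (auto simp: fun_eq_iff restr_def unit_seq_def if_distrib cong: if_cong)

lemma restr_finite_mem: "finite A \<Longrightarrow> restr A x \<in> X"
  unfolding restr_finite_eq by (intro sum_mem scale unit_mem)

lemma norm_restr_finite:
  "finite A \<Longrightarrow> N (restr A x) \<le> (\<Sum>i\<in>A. cmod (x i) * N (unit_seq i))"
  unfolding restr_finite_eq
  by (rule order.trans[OF norm_sum]) (auto simp: norm_scale unit_mem intro!: scale)

lemma norm_split: "x \<in> X \<Longrightarrow> N x \<le> N (restr {..<m} x) + N (restr {m..} x)"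
proof -
  assume x: "x \<in> X"
  have eq: "(\<lambda>n. restr {..<m} x n + restr {m..} x n) = x"
    by (auto simp: restr_def)
  show ?thesis
    using norm_add[OF restr_mem[OF x, of "{..<m}"] restr_mem[OF x, of "{m..}"]] unfolding eq .
qed

lemma tendsto_coord:
  assumes "\<And>k. f k \<in> X" "x \<in> X" "(\<lambda>k. N (\<lambda>n. f k n - x n)) \<longlonglongrightarrow> 0"
  shows "(\<lambda>k. f k i) \<longlonglongrightarrow> x i"
proof -
  obtain K where K: "\<And>y. y \<in> X \<Longrightarrow> cmod (y i) \<le> K * N y" using coord by blast
  have "(\<lambda>k. f k i - x i) \<longlonglongrightarrow> 0"
    by (rule Lim_null_comparison[OF always_eventually tendsto_mult_right_zero[OF assms(3)]])
       (use K[OF diff[OF assms(1,2)]] in auto)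
  then show ?thesis by (simp add: LIM_zero_iff)
qed

text \<open>
  The coordinatewise limit \<open>x\<close> of a Cauchy sequence is close to its late members on every finite
  interval, with a bound that does not depend on the interval, since there the norm is controlled by
  finitely many coordinates. Hence the truncations of \<open>x\<close> form a Cauchy sequence, and since tails are
  small, closeness on all finite intervals is closeness in norm.
\<close>
lemma complete:
  assumes f: "\<And>k. f k \<in> X"
    and cau: "\<And>\<epsilon>. \<epsilon> > 0 \<Longrightarrow> \<exists>M. \<forall>k\<ge>M. \<forall>l\<ge>M. N (\<lambda>n. f k n - f l n) \<le> \<epsilon>"
  shows "\<exists>x\<in>X. (\<lambda>k. N (\<lambda>n. f k n - x n)) \<longlonglongrightarrow> 0"
proof -
  have "\<exists>c. (\<lambda>k. f k i) \<longlonglongrightarrow> c" for i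
  proof -
    obtain K where K: "K \<ge> 0" "\<And>y. y \<in> X \<Longrightarrow> cmod (y i) \<le> K * N y" using coord by blast
    have "Cauchy (\<lambda>k. f k i)"
    proof (rule metric_CauchyI)
      fix \<epsilon> :: real assume "\<epsilon> > 0"
      then obtain M where M: "\<forall>k\<ge>M. \<forall>l\<ge>M. N (\<lambda>n. f k n - f l n) \<le> \<epsilon> / (K + 1)"
        using cau[of "\<epsilon> / (K + 1)"] K(1) by auto
      have "dist (f k i) (f l i) < \<epsilon>" if "k \<ge> M" "l \<ge> M" for k l
      proof -
        have "dist (f k i) (f l i) \<le> K * N (\<lambda>n. f k n - f l n)"
          using K(2)[OF diff[OF f f]] by (simp add: dist_norm)
        also have "\<dots> \<le> K * (\<epsilon> / (K + 1))"
          using M that K(1) by (intro mult_left_mono) auto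
        also have "\<dots> < \<epsilon>" using K(1) \<open>\<epsilon> > 0\<close> by (simp add: field_simps)
        finally show ?thesis .
      qed
      then show "\<exists>M. \<forall>m\<ge>M. \<forall>n\<ge>M. dist (f m i) (f n i) < \<epsilon>" by blast
    qed
    then show ?thesis using Cauchy_convergent_iff convergent_def by blast
  qed
  then obtain x where x: "\<And>i. (\<lambda>k. f k i) \<longlonglongrightarrow> x i" by metis
  \<comment> \<open>On a finite interval the limit in the second index can be taken, at the price of \<open>e\<close>.\<close>
  have trunc: "N (restr {m..<n} (\<lambda>i. f k i - x i)) \<le> \<epsilon>"
    if "k \<ge> M" and M: "\<forall>k\<ge>M. \<forall>l\<ge>M. N (\<lambda>n. f k n - f l n) \<le> \<epsilon>" for \<epsilon> M k m n
  proof (rule field_le_epsilon)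
    fix e :: real assume "e > 0"
    have "(\<lambda>l. \<Sum>i\<in>{m..<n}. cmod (f l i - x i) * N (unit_seq i)) \<longlonglongrightarrow>
          (\<Sum>i\<in>{m..<n}. cmod (x i - x i) * N (unit_seq i))"
      by (intro tendsto_intros x)
    then have "\<forall>\<^sub>F l in sequentially. (\<Sum>i\<in>{m..<n}. cmod (f l i - x i) * N (unit_seq i)) < e"
      using \<open>e > 0\<close> by (simp add: order_tendstoD)
    then obtain l where l: "l \<ge> M" "(\<Sum>i\<in>{m..<n}. cmod (f l i - x i) * N (unit_seq i)) < e"
      unfolding eventually_sequentially by (metis nle_le)
    have eq: "restr {m..<n} (\<lambda>i. f k i - x i) =
        (\<lambda>j. restr {m..<n} (\<lambda>i. f k i - f l i) j + restr {m..<n} (\<lambda>i. f l i - x i) j)"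
      by (auto simp: restr_def)
    have "N (restr {m..<n} (\<lambda>i. f k i - x i)) \<le>
        N (restr {m..<n} (\<lambda>i. f k i - f l i)) + N (restr {m..<n} (\<lambda>i. f l i - x i))"
      unfolding eq by (intro norm_add restr_finite_mem) auto
    also have "N (restr {m..<n} (\<lambda>i. f k i - f l i)) \<le> \<epsilon>"
      using norm_restr[OF diff[OF f f]] M that(1) l(1) by (meson order.trans)
    also have "N (restr {m..<n} (\<lambda>i. f l i - x i)) \<le> e"
      by (rule order.trans[OF norm_restr_finite]) (use l(2) in auto)
    finally show "N (restr {m..<n} (\<lambda>i. f k i - x i)) \<le> \<epsilon> + e" by simp
  qed
  have "x \<in> X"
  proof (rule Cauchy_truncations)
    fix \<epsilon> :: real assume "\<epsilon> > 0"
    then obtain M where M: "\<forall>k\<ge>M. \<forall>l\<ge>M. N (\<lambda>n. f k n - f l n) \<le> \<epsilon>/2"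
      using cau[of "\<epsilon>/2"] by auto
    obtain m where m: "N (restr {m..} (f M)) < \<epsilon>/2"
      using order_tendstoD(2)[OF tail[OF f[of M]], of "\<epsilon>/2"] \<open>\<epsilon> > 0\<close>
      by (force simp: eventually_sequentially)
    have "N (restr {m..<n} x) \<le> \<epsilon>" for n
    proof -
      have eq: "restr {m..<n} x =
          (\<lambda>j. restr {m..<n} (f M) j - restr {m..<n} (\<lambda>i. f M i - x i) j)"
        by (auto simp: restr_def)
      have "N (restr {m..<n} x) \<le> N (restr {m..<n} (f M)) + N (restr {m..<n} (\<lambda>i. f M i - x i))"
        unfolding eq by (intro norm_diff restr_finite_mem) auto
      also have "N (restr {m..<n} (f M)) \<le> N (restr {m..} (f M))"
        by (rule norm_solid) (auto simp: restr_def intro: restr_mem[unfolded restr_def[abs_def]] f restr_mem)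
      finally show ?thesis using trunc[OF _ M, of M m n] m by simp
    qed
    then show "\<exists>m. \<forall>n. N (restr {m..<n} x) \<le> \<epsilon>" by blast
  qed
  moreover have "(\<lambda>k. N (\<lambda>n. f k n - x n)) \<longlonglongrightarrow> 0"
  proof (rule tendstoI)
    fix \<epsilon> :: real assume "\<epsilon> > 0"
    then obtain M where M: "\<forall>k\<ge>M. \<forall>l\<ge>M. N (\<lambda>n. f k n - f l n) \<le> \<epsilon>/2"
      using cau[of "\<epsilon>/2"] by auto
    have "N (\<lambda>n. f k n - x n) < \<epsilon>" if "k \<ge> M" for k
    proof -
      have mem: "(\<lambda>n. f k n - x n) \<in> X" using f \<open>x \<in> X\<close> by (rule diff)
      obtain m where m: "N (restr {m..} (\<lambda>n. f k n - x n)) < \<epsilon>/2"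
        using order_tendstoD(2)[OF tail[OF mem], of "\<epsilon>/2"] \<open>\<epsilon> > 0\<close>
        by (force simp: eventually_sequentially)
      then show ?thesis
        using norm_split[OF mem, of m] trunc[OF that M, of 0 m] by (simp add: atLeast0LessThan)
    qed
    then show "\<forall>\<^sub>F k in sequentially. dist (N (\<lambda>n. f k n - x n)) 0 < \<epsilon>"
      using norm_nonneg[OF diff[OF f \<open>x \<in> X\<close>]] by (auto simp: eventually_sequentially)
  qed
  ultimately show ?thesis by blast
qed

lemma absolutely_convergent_series:
  assumes f: "\<And>j. f j \<in> X" and s: "summable (\<lambda>j. N (f j))"
    and x: "\<And>n. (\<lambda>j. f j n) sums x n"
  shows "x \<in> X" "N x \<le> (\<Sum>j. N (f j))"
proof -
  define S where "S k = (\<lambda>n. \<Sum>j<k. f j n)" for k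
  have S: "S k \<in> X" for k unfolding S_def by (intro sum_mem f)
  have inc: "N (\<lambda>n. S k n - S l n) \<le> (\<Sum>j=l..<k. N (f j))" if "l \<le> k" for k l
  proof -
    have "(\<lambda>n. S k n - S l n) = (\<lambda>n. \<Sum>j=l..<k. f j n)"
      using sum_diff_nat_ivl[of 0 l k] that by (auto simp: S_def atLeast0LessThan fun_eq_iff)
    then show ?thesis by (simp add: norm_sum f)
  qed
  have "\<exists>M. \<forall>k\<ge>M. \<forall>l\<ge>M. N (\<lambda>n. S k n - S l n) \<le> \<epsilon>" if eps: "\<epsilon> > 0" for \<epsilon>
  proof -
    obtain M where M: "\<And>m n. m \<ge> M \<Longrightarrow> norm (\<Sum>j=m..<n. N (f j)) < \<epsilon>"
      using s eps unfolding summable_Cauchy by blast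
    have le: "N (\<lambda>n. S k n - S l n) \<le> \<epsilon>" if "l \<ge> M" "l \<le> k" for k l
      using inc[OF that(2)] M[OF that(1), of k] by auto
    have "N (\<lambda>n. S k n - S l n) \<le> \<epsilon>" if "k \<ge> M" "l \<ge> M" for k l
      using le[of l k] le[of k l] that norm_diff_commute[OF S S, of k l] by (cases "l \<le> k") auto
    then show ?thesis by blast
  qed
  from complete[OF S this] obtain y where y: "y \<in> X" "(\<lambda>k. N (\<lambda>n. S k n - y n)) \<longlonglongrightarrow> 0" by blast
  have "y n = x n" for n
    using tendsto_coord[OF S y, of n] x[of n] unfolding sums_def S_def by (rule LIMSEQ_unique)
  then have "y = x" by blast
  with y show "x \<in> X" by simp
  have "N x \<le> (\<Sum>j. N (f j))"
  proof (rule LIMSEQ_le_const[where X = "\<lambda>k. (\<Sum>j. N (f j)) + N (\<lambda>n. S k n - x n)"])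
    show "(\<lambda>k. (\<Sum>j. N (f j)) + N (\<lambda>n. S k n - x n)) \<longlonglongrightarrow> (\<Sum>j. N (f j))"
      using tendsto_add[OF tendsto_const y(2)] \<open>y = x\<close> by simp
    have "N x \<le> (\<Sum>j. N (f j)) + N (\<lambda>n. S k n - x n)" for k
    proof -
      have "N x \<le> N (S k) + N (\<lambda>n. S k n - x n)"
        using norm_diff[OF S[of k] diff[OF S[of k] \<open>x \<in> X\<close>]] by simp
      also have "N (S k) \<le> (\<Sum>j<k. N (f j))" unfolding S_def by (intro norm_sum f)
      also have "\<dots> \<le> (\<Sum>j. N (f j))" by (rule sum_le_suminf[OF s]) (auto intro: norm_nonneg f)
      finally show ?thesis by simp
    qed
    then show "\<exists>M. \<forall>n\<ge>M. N x \<le> (\<Sum>j. N (f j)) + N (\<lambda>na. S n na - x na)" by blast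
  qed
  then show "N x \<le> (\<Sum>j. N (f j))" .
qed

end

section \<open>Metric topology, bounded operators and total boundedness\<close>

context shift_lattice
begin

lemma Metric_space_seq_dist: "Metric_space X (seq_dist X N)"
proof
  show "0 \<le> seq_dist X N x y" for x y
    by (simp add: seq_dist_def norm_nonneg diff)
  show "seq_dist X N x y = seq_dist X N y x" for x y
    using norm_diff_commute[of x y] by (simp add: seq_dist_def)
  show "seq_dist X N x y = 0 \<longleftrightarrow> x = y" if "x \<in> X" "y \<in> X" for x y
    using norm_eq_zero[OF diff[OF that]] that norm_zero
    by (auto simp: seq_dist_def fun_eq_iff)
  show "seq_dist X N x z \<le> seq_dist X N x y + seq_dist X N y z"
    if "x \<in> X" "y \<in> X" "z \<in> X" for x y z
    using norm_diff_triangle[OF that] that by (simp add: seq_dist_def)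
qed

sublocale M: Metric_space X "seq_dist X N"
  by (rule Metric_space_seq_dist)

lemma mcomplete: "M.mcomplete"
  unfolding M.mcomplete_def
proof (intro allI impI)
  fix f assume f: "M.MCauchy f"
  then have mem: "f k \<in> X" for k by (auto simp: M.MCauchy_def)
  have "\<exists>M. \<forall>k\<ge>M. \<forall>l\<ge>M. N (\<lambda>n. f k n - f l n) \<le> \<epsilon>" if eps: "\<epsilon> > 0" for \<epsilon>
  proof -
    obtain M where "\<And>k l. M \<le> k \<Longrightarrow> M \<le> l \<Longrightarrow> seq_dist X N (f k) (f l) < \<epsilon>"
      using f eps unfolding M.MCauchy_def by blast
    then have "\<forall>k\<ge>M. \<forall>l\<ge>M. N (\<lambda>n. f k n - f l n) \<le> \<epsilon>"
      by (auto simp: seq_dist_def mem intro: less_imp_le)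
    then show ?thesis by blast
  qed
  from complete[OF mem this] obtain x where x: "x \<in> X" "(\<lambda>k. N (\<lambda>n. f k n - x n)) \<longlonglongrightarrow> 0" by blast
  have "limitin M.mtopology f x sequentially"
    unfolding M.limit_metric_sequentially
  proof (intro conjI allI impI x(1))
    fix \<epsilon> :: real assume "\<epsilon> > 0"
    from order_tendstoD(2)[OF x(2) this] obtain M where "\<forall>k\<ge>M. N (\<lambda>n. f k n - x n) < \<epsilon>"
      unfolding eventually_sequentially by blast
    then show "\<exists>M. \<forall>n\<ge>M. f n \<in> X \<and> seq_dist X N (f n) x < \<epsilon>"
      using mem x(1) by (auto simp: seq_dist_def)
  qed
  then show "\<exists>x. limitin M.mtopology f x sequentially" by blast
qed

lemma linear_opsD_add:
  "T \<in> linear_ops X \<Longrightarrow> x \<in> X \<Longrightarrow> y \<in> X \<Longrightarrow> T (\<lambda>n. x n + y n) = (\<lambda>n. T x n + T y n)"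
  by (simp add: linear_ops_def)

lemma linear_ops_diff:
  assumes T: "T \<in> linear_ops X" and "x \<in> X" "y \<in> X"
  shows "T (\<lambda>n. x n - y n) = (\<lambda>n. T x n - T y n)"
proof -
  have "T (\<lambda>n. x n + (-1) * y n) = (\<lambda>n. T x n + T (\<lambda>n. (-1) * y n) n)"
    by (rule linear_opsD_add[OF T assms(2) scale[OF assms(3)]])
  also have "T (\<lambda>n. (-1) * y n) = (\<lambda>n. (-1) * T y n)"
    using T assms(3) unfolding linear_ops_def by blast
  finally show ?thesis by simp
qed

lemma bounded_imp_cont_linear_ops:
  assumes T: "T \<in> linear_ops X" and C: "\<And>x. x \<in> X \<Longrightarrow> N (T x) \<le> C * N x"
  shows "T \<in> cont_linear_ops X N"
proof -
  have mem: "T x \<in> X" if "x \<in> X" for x using T that by (simp add: linear_ops_def)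
  have "continuous_map M.mtopology M.mtopology T"
    unfolding M.metric_continuous_map[OF Metric_space_seq_dist]
  proof (intro conjI ballI allI impI)
    show "T ` X \<subseteq> X" using mem by blast
    fix a and \<epsilon> :: real assume a: "a \<in> X" and "\<epsilon> > 0"
    define D where "D = \<bar>C\<bar> + 1"
    have "seq_dist X N (T a) (T x) < \<epsilon>" if x: "x \<in> X" "seq_dist X N a x < \<epsilon> / D" for x
    proof -
      have d: "(\<lambda>n. a n - x n) \<in> X" using a x(1) by (rule diff)
      have "seq_dist X N (T a) (T x) = N (T (\<lambda>n. a n - x n))"
        by (simp add: linear_ops_diff[OF T a x(1)] seq_dist_def mem a x)
      also have "\<dots> \<le> C * N (\<lambda>n. a n - x n)" by (rule C[OF d])
      also have "\<dots> \<le> D * N (\<lambda>n. a n - x n)"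
        by (intro mult_right_mono norm_nonneg d) (simp add: D_def)
      also have "\<dots> < \<epsilon>"
        using x a by (simp add: seq_dist_def D_def field_simps)
      finally show ?thesis .
    qed
    moreover have "\<epsilon> / D > 0" using \<open>\<epsilon> > 0\<close> by (simp add: D_def)
    ultimately show "\<exists>\<delta>>0. \<forall>x. x \<in> X \<and> seq_dist X N a x < \<delta> \<longrightarrow> seq_dist X N (T a) (T x) < \<epsilon>"
      by blast
  qed
  then show ?thesis using T by (simp add: cont_linear_ops_def norm_top_def)
qed

text \<open>
  The inverse inherits linearity from injectivity, so an operator is shown to be invertible by
  exhibiting, for every right-hand side, one solution with a norm estimate.
\<close>

lemma invertible_opI:
  assumes T: "T \<in> cont_linear_ops X N" and inj: "inj_on T X"
    and solve: "\<And>y. y \<in> X \<Longrightarrow> \<exists>x\<in>X. T x = y \<and> N x \<le> C * N y"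
  shows "invertible_op X N T"
proof -
  define S where "S = inv_into X T"
  have lin: "T \<in> linear_ops X" using T by (simp add: cont_linear_ops_def)
  have ST: "S (T x) = x" if "x \<in> X" for x
    unfolding S_def using inj that by (rule inv_into_f_f)
  have S: "S y \<in> X" "T (S y) = y" "N (S y) \<le> C * N y" if "y \<in> X" for y
    using solve[OF that] ST by auto
  have S_eqI: "S y = x" if "x \<in> X" "T x = y" for x y
    using ST that by blast
  have "S \<in> linear_ops X"
    unfolding linear_ops_def
  proof (intro CollectI conjI ballI allI)
    show "S x \<in> X" if "x \<in> X" for x using S that by blast
    show "S (\<lambda>n. x n + y n) = (\<lambda>n. S x n + S y n)" if "x \<in> X" "y \<in> X" for x y
    proof (rule S_eqI)
      have "T (\<lambda>n. S x n + S y n) = (\<lambda>n. T (S x) n + T (S y) n)"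
        using lin S(1)[OF that(1)] S(1)[OF that(2)] unfolding linear_ops_def by blast
      then show "T (\<lambda>n. S x n + S y n) = (\<lambda>n. x n + y n)" using S that by simp
    qed (intro add S that)
    show "S (\<lambda>n. c * x n) = (\<lambda>n. c * S x n)" if "x \<in> X" for c x
    proof (rule S_eqI)
      have "T (\<lambda>n. c * S x n) = (\<lambda>n. c * T (S x) n)"
        using lin S(1)[OF that] unfolding linear_ops_def by blast
      then show "T (\<lambda>n. c * S x n) = (\<lambda>n. c * x n)" using S that by simp
    qed (intro scale S that)
  qed
  then have "S \<in> cont_linear_ops X N"
    using S(3) by (rule bounded_imp_cont_linear_ops)
  then show ?thesis
    unfolding invertible_op_def using T ST S(2) by blast
qed

text \<open>
  A bound on the norm bounds every coordinate, so by Tychonoff's theorem a sequence in \<open>S\<close> has a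
  subsequence that converges coordinatewise. Small tails reduce the norm of a difference to finitely
  many coordinates, so that this subsequence is Cauchy in norm.
\<close>

lemma mtotally_bounded_if_small_tails:
  assumes S: "S \<subseteq> X" and B: "\<And>x. x \<in> S \<Longrightarrow> N x \<le> B"
    and tails: "\<And>\<epsilon>. \<epsilon> > 0 \<Longrightarrow> \<exists>m. \<forall>x\<in>S. N (restr {m..} x) \<le> \<epsilon>"
  shows "M.mtotally_bounded S"
  unfolding M.mtotally_bounded_sequentially
proof (intro conjI S allI impI)
  fix \<sigma> :: "nat \<Rightarrow> cseq" assume "range \<sigma> \<subseteq> S"
  then have \<sigma>: "\<sigma> k \<in> S" "\<sigma> k \<in> X" for k using S by auto
  obtain K where K: "\<And>n. K n \<ge> 0" "\<And>n x. x \<in> X \<Longrightarrow> cmod (x n) \<le> K n * N x"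
    using coord by metis
  define P where "P = Pi\<^sub>E UNIV (\<lambda>n. cball (0::complex) (K n * B))"
  have "compactin (product_topology (\<lambda>i. euclidean) UNIV) P"
    unfolding P_def compactin_PiE by (auto simp: compactin_euclidean_iff)
  then have "compact P"
    unfolding euclidean_product_topology by (simp add: compactin_euclidean_iff)
  moreover have "\<sigma> k \<in> P" for k
  proof -
    have "cmod (\<sigma> k n) \<le> K n * B" for n
      using K(2)[OF \<sigma>(2), of k n] mult_left_mono[OF B[OF \<sigma>(1)[of k]] K(1)[of n]] by linarith
    then show ?thesis by (auto simp: P_def)
  qed
  ultimately obtain x r where r: "strict_mono r" "(\<sigma> \<circ> r) \<longlonglongrightarrow> x"
    using compact_imp_seq_compact[of P] unfolding seq_compact_def by metis
  define f where "f = \<sigma> \<circ> r"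
  have f: "f k \<in> S" "f k \<in> X" for k by (simp_all add: f_def \<sigma>)
  have lim: "(\<lambda>k. f k i) \<longlonglongrightarrow> x i" for i
    using continuous_on_tendsto_compose[OF continuous_on_product_coordinates[of i] r(2)]
    by (simp add: f_def)
  have "M.MCauchy f"
    unfolding M.MCauchy_def
  proof (intro conjI allI impI)
    show "range f \<subseteq> X" using f by blast
    fix \<epsilon> :: real assume "\<epsilon> > 0"
    then obtain m where m: "\<And>x. x \<in> S \<Longrightarrow> N (restr {m..} x) \<le> \<epsilon>/4"
      using tails[of "\<epsilon>/4"] by auto
    have "(\<lambda>k. \<Sum>i<m. cmod (f k i - x i) * N (unit_seq i)) \<longlonglongrightarrow>
          (\<Sum>i<m. cmod (x i - x i) * N (unit_seq i))"
      by (intro tendsto_intros lim)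
    from order_tendstoD(2)[OF this, of "\<epsilon>/4"]
    have "\<forall>\<^sub>F k in sequentially. (\<Sum>i<m. cmod (f k i - x i) * N (unit_seq i)) < \<epsilon>/4"
      using \<open>\<epsilon> > 0\<close> by simp
    then obtain L where L: "\<And>k. k \<ge> L \<Longrightarrow> (\<Sum>i<m. cmod (f k i - x i) * N (unit_seq i)) < \<epsilon>/4"
      unfolding eventually_sequentially by blast
    have head: "N (restr {..<m} (\<lambda>n. f k n - x n)) < \<epsilon>/4" if "k \<ge> L" for k
      using norm_restr_finite[of "{..<m}" "\<lambda>n. f k n - x n"] L[OF that] by simp
    have "seq_dist X N (f k) (f l) < \<epsilon>" if kl: "k \<ge> L" "l \<ge> L" for k l
    proof -
      have d: "(\<lambda>n. f k n - f l n) \<in> X" by (intro diff f)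
      have e1: "restr {..<m} (\<lambda>n. f k n - f l n) =
          (\<lambda>j. restr {..<m} (\<lambda>n. f k n - x n) j - restr {..<m} (\<lambda>n. f l n - x n) j)"
        and e2: "restr {m..} (\<lambda>n. f k n - f l n) =
          (\<lambda>j. restr {m..} (f k) j - restr {m..} (f l) j)"
        by (auto simp: restr_def)
      have "N (restr {..<m} (\<lambda>n. f k n - f l n)) \<le>
          N (restr {..<m} (\<lambda>n. f k n - x n)) + N (restr {..<m} (\<lambda>n. f l n - x n))"
        unfolding e1 by (intro norm_diff restr_finite_mem) auto
      moreover have "N (restr {m..} (\<lambda>n. f k n - f l n)) \<le>
          N (restr {m..} (f k)) + N (restr {m..} (f l))"
        unfolding e2 by (intro norm_diff restr_mem f)
      ultimately have "N (\<lambda>n. f k n - f l n) < \<epsilon>"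
        using norm_split[OF d, of m] head[OF kl(1)] head[OF kl(2)] m[OF f(1)[of k]] m[OF f(1)[of l]]
        by linarith
      then show ?thesis by (simp add: seq_dist_def f)
    qed
    then show "\<exists>L. \<forall>k k'. L \<le> k \<longrightarrow> L \<le> k' \<longrightarrow> seq_dist X N (f k) (f k') < \<epsilon>" by blast
  qed
  then show "\<exists>r. strict_mono r \<and> M.MCauchy (\<sigma> \<circ> r)"
    using r(1) unfolding f_def by blast
qed

end

section \<open>Geometric convolution and the norm and compactness of the Cesaro operator\<close>

definition geom_conv :: "real \<Rightarrow> cseq \<Rightarrow> cseq" where
  "geom_conv r x n = (\<Sum>k\<le>n. of_real r ^ (n - k) * x k)"

lemma cesaro_eq_geom_conv: "cesaro t x n = geom_conv t x n / of_nat (Suc n)"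
  by (simp add: cesaro_def geom_conv_def)

lemma geom_conv_0 [simp]: "geom_conv r x 0 = x 0"
  by (simp add: geom_conv_def)

lemma geom_conv_Suc: "geom_conv r x (Suc n) = of_real r * geom_conv r x n + x (Suc n)"
proof -
  have "(\<Sum>k\<le>n. of_real r ^ (Suc n - k) * x k) = (\<Sum>k\<le>n. of_real r * (of_real r ^ (n - k) * x k))"
    by (rule sum.cong) (simp_all add: Suc_diff_le)
  then show ?thesis by (simp add: geom_conv_def sum_distrib_left)
qed

lemma right_shift_0 [simp]: "right_shift x 0 = 0"
  and right_shift_Suc [simp]: "right_shift x (Suc n) = x n"
  by (simp_all add: right_shift_def)

lemma geom_conv_inverse: "geom_conv r (\<lambda>n. z n - of_real r * right_shift z n) = z"
proof
  show "geom_conv r (\<lambda>n. z n - of_real r * right_shift z n) n = z n" for n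
    by (induction n) (simp_all add: geom_conv_Suc)
qed

lemma funpow_right_shift: "(right_shift ^^ j) x n = (if j \<le> n then x (n - j) else 0)"
  by (induction j arbitrary: n) (auto simp: right_shift_def split: nat.split)

lemma geom_conv_eq_sum_shifts:
  "geom_conv r x n = (\<Sum>j\<le>n. of_real r ^ j * (right_shift ^^ j) x n)"
  unfolding geom_conv_def
  by (rule sum.reindex_bij_witness[of _ "\<lambda>j. n - j" "\<lambda>j. n - j"]) (auto simp: funpow_right_shift)

context shift_lattice
begin

lemma geom_conv_mem_and_norm:
  assumes r: "0 \<le> r" "r < 1" and x: "x \<in> X"
  shows geom_conv_mem: "geom_conv r x \<in> X"
    and norm_geom_conv: "N (geom_conv r x) \<le> N x / (1 - r)"
proof -
  define f where "f j = (\<lambda>n. of_real r ^ j * (right_shift ^^ j) x n)" for j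
  have sh: "(right_shift ^^ j) x \<in> X \<and> N ((right_shift ^^ j) x) \<le> N x" for j
    by (induction j) (auto simp: x shift intro: order.trans[OF norm_shift])
  have f: "f j \<in> X" for j unfolding f_def using sh by (intro scale) auto
  have Nf: "N (f j) \<le> r ^ j * N x" for j
    using sh[of j] r mult_left_mono[of "N ((right_shift ^^ j) x)" "N x" "r ^ j"]
    by (simp add: f_def norm_scale norm_power)
  have sums: "(\<lambda>j. r ^ j * N x) sums (N x / (1 - r))"
    using sums_mult2[OF geometric_sums[of r], of "N x"] r by simp
  have s: "summable (\<lambda>j. N (f j))"
    by (rule summable_comparison_test'[OF sums_summable[OF sums], of 0])
       (use Nf norm_nonneg[OF f] in auto)
  have "(\<lambda>j. f j n) sums geom_conv r x n" for n
    unfolding geom_conv_eq_sum_shifts f_def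
    by (rule sums_finite) (auto simp: funpow_right_shift)
  from absolutely_convergent_series[OF f s this]
  have *: "geom_conv r x \<in> X" "N (geom_conv r x) \<le> (\<Sum>j. N (f j))" .
  show "geom_conv r x \<in> X" by fact
  show "N (geom_conv r x) \<le> N x / (1 - r)"
    using *(2) suminf_le[OF Nf s sums_summable[OF sums]] sums_unique[OF sums] by linarith
qed

lemma cmod_cesaro_le: "cmod (cesaro t x n) \<le> cmod (geom_conv t x n)"
  unfolding cesaro_eq_geom_conv norm_divide norm_of_nat
  by (rule divide_le_eq[THEN iffD2]) (use mult_left_mono[of 1 "1 + real n" "cmod (geom_conv t x n)"] in auto)

context
  fixes t :: real
  assumes t: "0 \<le> t" "t < 1"
begin

lemma cesaro_mem: "x \<in> X \<Longrightarrow> cesaro t x \<in> X"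
  by (rule solid[OF geom_conv_mem[OF t] cmod_cesaro_le])

lemma norm_cesaro: "x \<in> X \<Longrightarrow> N (cesaro t x) \<le> N x / (1 - t)"
  by (rule order.trans[OF norm_solid[OF geom_conv_mem[OF t] cmod_cesaro_le] norm_geom_conv[OF t]])

text \<open>
  The factor \<open>1 / (n + 1)\<close> makes the tails of \<open>cesaro t x\<close> small, uniformly for \<open>x\<close> in the unit ball;
  this is the source of compactness.
\<close>

lemma norm_cesaro_tail:
  assumes x: "x \<in> X"
  shows "N (restr {m..} (cesaro t x)) \<le> N x / (1 - t) / (1 + real m)"
proof -
  let ?y = "\<lambda>n. (1 / (1 + of_nat m)) * geom_conv t x n"
  have g: "geom_conv t x \<in> X" by (rule geom_conv_mem[OF t x])
  have c: "cmod (1 / (1 + of_nat m)) = 1 / (1 + real m)"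
    using norm_of_nat[of "Suc m", where 'a = complex] by (simp add: norm_divide)
  have "cmod (restr {m..} (cesaro t x) n) \<le> cmod (?y n)" for n
  proof (cases "m \<le> n")
    case True
    have "cmod (cesaro t x n) = cmod (geom_conv t x n) / (1 + real n)"
      using norm_of_nat[of "Suc n", where 'a = complex] by (simp add: cesaro_eq_geom_conv norm_divide)
    also have "\<dots> \<le> cmod (geom_conv t x n) / (1 + real m)"
      using True by (intro divide_left_mono) auto
    also have "\<dots> = cmod (?y n)" by (simp only: norm_mult c) simp
    finally show ?thesis using True by (simp add: restr_def)
  qed (simp add: restr_def)
  then have "N (restr {m..} (cesaro t x)) \<le> N ?y"
    by (intro norm_solid scale g)
  also have "\<dots> = N (geom_conv t x) / (1 + real m)"
    by (simp only: norm_scale[OF g] c) simp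
  also have "\<dots> \<le> N x / (1 - t) / (1 + real m)"
    by (intro divide_right_mono norm_geom_conv t x) auto
  finally show ?thesis .
qed

lemma cesaro_linear: "cesaro t \<in> linear_ops X"
proof -
  have "cesaro t (\<lambda>n. x n + y n) n = cesaro t x n + cesaro t y n" for x y n
    by (simp add: cesaro_def distrib_left sum.distrib)
  moreover have "cesaro t (\<lambda>n. c * x n) n = c * cesaro t x n" for c x n
    by (simp add: cesaro_def sum_distrib_left mult.left_commute)
  ultimately show ?thesis
    by (simp add: linear_ops_def cesaro_mem fun_eq_iff)
qed

lemma cesaro_cont: "cesaro t \<in> cont_linear_ops X N"
  by (rule bounded_imp_cont_linear_ops[OF cesaro_linear, of "1 / (1 - t)"])
     (use norm_cesaro in auto)

lemma shift_cesaro_cont: "shift_op (cesaro t) l \<in> cont_linear_ops X N"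
proof (rule bounded_imp_cont_linear_ops)
  have mem: "shift_op (cesaro t) l x \<in> X" if "x \<in> X" for x
    unfolding shift_op_def using that by (intro diff cesaro_mem scale)
  show "shift_op (cesaro t) l \<in> linear_ops X"
    using cesaro_linear mem
    by (auto simp: linear_ops_def shift_op_def fun_eq_iff algebra_simps)
  show "N (shift_op (cesaro t) l x) \<le> (1 / (1 - t) + cmod l) * N x" if "x \<in> X" for x
    using norm_diff[OF cesaro_mem[OF that] scale[OF that, of l]] norm_cesaro[OF that]
    by (simp add: shift_op_def norm_scale that algebra_simps)
qed

lemma op_norm_cesaro: "op_norm X N (cesaro t) \<le> inverse (1 - t)"
  unfolding op_norm_def
proof (rule cSUP_least)
  show "{x \<in> X. N x \<le> 1} \<noteq> {}" using zero norm_zero by force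
  fix x assume "x \<in> {x \<in> X. N x \<le> 1}"
  then have "N (cesaro t x) \<le> N x / (1 - t)" "N x \<le> 1" using norm_cesaro by auto
  then show "N (cesaro t x) \<le> inverse (1 - t)"
    using divide_right_mono[of "N x" 1 "1 - t"] t by (simp add: inverse_eq_divide)
qed

lemma compact_cesaro: "compact_op X N (cesaro t)"
proof -
  let ?S = "cesaro t ` {x \<in> X. N x \<le> 1}"
  define B where "B = 1 / (1 - t)"
  have le: "N x / (1 - t) \<le> B" if "N x \<le> 1" for x
    unfolding B_def using t that by (intro divide_right_mono) auto
  have "M.mtotally_bounded ?S"
  proof (rule mtotally_bounded_if_small_tails[where B = B])
    show "?S \<subseteq> X" using cesaro_mem by blast
    show "N y \<le> B" if "y \<in> ?S" for y
      using that le norm_cesaro by fastforce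
    fix \<epsilon> :: real assume "\<epsilon> > 0"
    have "(\<lambda>m. B * inverse (real (Suc m))) \<longlonglongrightarrow> B * 0"
      by (intro tendsto_intros LIMSEQ_inverse_real_of_nat)
    then have "\<forall>\<^sub>F m in sequentially. B * inverse (real (Suc m)) < \<epsilon>"
      using \<open>\<epsilon> > 0\<close> by (simp add: order_tendstoD)
    then obtain m where m: "B * inverse (real (Suc m)) < \<epsilon>"
      unfolding eventually_sequentially by blast
    have "N (restr {m..} (cesaro t x)) \<le> \<epsilon>" if "x \<in> X" "N x \<le> 1" for x
    proof -
      have "N (restr {m..} (cesaro t x)) \<le> N x / (1 - t) / (1 + real m)"
        by (rule norm_cesaro_tail[OF that(1)])
      also have "\<dots> \<le> B / (1 + real m)" by (intro divide_right_mono le that) auto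
      also have "\<dots> \<le> \<epsilon>" using m by (simp add: field_simps)
      finally show ?thesis .
    qed
    then show "\<exists>m. \<forall>y\<in>?S. N (restr {m..} y) \<le> \<epsilon>" by blast
  qed
  then show ?thesis
    using M.mtotally_bounded_eq_compact_closure_of[OF mcomplete] cesaro_cont
    by (simp add: compact_op_def norm_top_def)
qed

end
end

section \<open>Two-term recursions and injectivity\<close>

text \<open>
  If all weights \<open>w n\<close> were at most \<open>r\<close>, the recursion would give the bound with \<open>C = c\<close>. The finitely
  many weights above \<open>r\<close> cost the factor \<open>\<Prod>\<^sub>i max 1 (w i / r)\<close>, whose partial products \<open>Q n\<close> are
  eventually constant. The constant \<open>C\<close> must not depend on \<open>y\<close> and \<open>z\<close>, since it bounds an operator.
\<close>

lemma dominated_by_geometric_sum: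
  fixes w :: "nat \<Rightarrow> real"
  assumes r: "0 < r" and w: "\<And>n. 0 \<le> w n" "\<forall>\<^sub>F n in sequentially. w n \<le> r" and c: "0 \<le> c"
  obtains C where "0 \<le> C"
    "\<And>(z :: cseq) y n. cmod (z 0) \<le> c * cmod (y 0) \<Longrightarrow>
       (\<And>n. cmod (z (Suc n)) \<le> c * cmod (y (Suc n)) + w n * cmod (z n)) \<Longrightarrow>
       cmod (z n) \<le> C * cmod (geom_conv r (abs_seq y) n)"
proof -
  define Q where "Q n = (\<Prod>i<n. max 1 (w i / r))" for n
  have Q_Suc: "Q (Suc n) = Q n * max 1 (w n / r)" for n by (simp add: Q_def)
  have Q_ge1: "1 \<le> Q n" for n unfolding Q_def by (intro prod_ge_1) auto
  have Q_mono: "Q n \<le> Q (Suc n)" for n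
    unfolding Q_Suc using Q_ge1[of n] by (simp add: mult_le_cancel_left1)
  have wQ: "w n * Q n \<le> r * Q (Suc n)" for n
  proof -
    have "w n \<le> r * max 1 (w n / r)" using r by (simp add: field_simps max_def)
    from mult_right_mono[OF this, of "Q n"] show ?thesis
      using Q_ge1[of n] by (simp add: Q_Suc mult_ac)
  qed
  obtain M where M: "\<And>n. n \<ge> M \<Longrightarrow> w n \<le> r"
    using w(2) unfolding eventually_sequentially by blast
  have Q_bound: "Q n \<le> Q M" for n
  proof (cases "n \<le> M")
    case True
    then show ?thesis by (rule lift_Suc_mono_le[of Q, OF Q_mono])
  next
    case False
    then have "M \<le> n" by simp
    then show ?thesis
    proof (induction n rule: dec_induct)
      case (step n)
      have "max 1 (w n / r) = 1" using M[OF step(1)] r by (simp add: max_def field_simps)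
      then show ?case using step by (simp add: Q_Suc)
    qed simp
  qed
  have "cmod (z n) \<le> c * Q M * cmod (geom_conv r (abs_seq y) n)"
    if z: "cmod (z 0) \<le> c * cmod (y 0)"
      "\<And>n. cmod (z (Suc n)) \<le> c * cmod (y (Suc n)) + w n * cmod (z n)" for z y :: cseq and n
  proof -
    define s where "s n = (\<Sum>k\<le>n. r ^ (n - k) * cmod (y k))" for n
    have s: "geom_conv r (abs_seq y) n = of_real (s n)" for n
      by (simp add: geom_conv_def abs_seq_def s_def)
    have s0: "0 \<le> s n" for n using r by (auto simp: s_def intro!: sum_nonneg)
    have "complex_of_real (s (Suc n)) = of_real (r * s n + cmod (y (Suc n)))" for n
      using geom_conv_Suc[of r "abs_seq y" n] unfolding s by (simp add: abs_seq_def)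
    then have s_Suc: "s (Suc n) = r * s n + cmod (y (Suc n))" for n
      by (simp only: of_real_eq_iff)
    have *: "cmod (z n) \<le> c * Q n * s n" for n
    proof (induction n)
      case 0
      then show ?case using z(1) by (simp add: Q_def s_def)
    next
      case (Suc n)
      have "cmod (z (Suc n)) \<le> c * cmod (y (Suc n)) + w n * (c * Q n * s n)"
        using z(2)[of n] mult_left_mono[OF Suc w(1)[of n]] by linarith
      also have "w n * (c * Q n * s n) = (w n * Q n) * (c * s n)" by simp
      also have "\<dots> \<le> (r * Q (Suc n)) * (c * s n)"
        using wQ c s0 by (intro mult_right_mono) auto
      also have "c * cmod (y (Suc n)) \<le> (c * cmod (y (Suc n))) * Q (Suc n)"
        using mult_left_mono[OF Q_ge1[of "Suc n"], of "c * cmod (y (Suc n))"] c by simp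
      finally show ?case by (simp add: s_Suc algebra_simps)
    qed
    have "c * Q n * s n \<le> c * Q M * s n"
      using Q_bound c s0 by (intro mult_right_mono mult_left_mono) auto
    then show ?thesis using *[of n] s0[of n] by (simp add: s)
  qed
  moreover have "0 \<le> c * Q M" using c Q_ge1[of M] by simp
  ultimately show ?thesis using that by blast
qed

text \<open>
  The operator is triangular with diagonal entries \<open>1 / (n + 1) - l\<close>, none of which is zero.
\<close>

lemma inj_shift_cesaro:
  assumes l: "l \<notin> Lam"
  shows "inj (shift_op (cesaro t) l)"
proof (rule injI)
  fix x y assume eq: "shift_op (cesaro t) l x = shift_op (cesaro t) l y"
  have "x n = y n" for n
  proof (induction n rule: less_induct)
    case (less n)
    define a :: complex where "a = 1 / of_nat (n + 1)"
    have split: "cesaro t u n = a * ((\<Sum>k<n. of_real t ^ (n - k) * u k) + u n)" for u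
      by (simp add: cesaro_def a_def lessThan_Suc_atMost[symmetric])
    have "(\<Sum>k<n. of_real t ^ (n - k) * x k) = (\<Sum>k<n. of_real t ^ (n - k) * y k)"
      using less by simp
    moreover have "cesaro t x n - l * x n = cesaro t y n - l * y n"
      using fun_cong[OF eq, of n] by (simp add: shift_op_def)
    ultimately have "(a - l) * (x n - y n) = 0"
      unfolding split by (simp add: algebra_simps)
    moreover have "a - l \<noteq> 0"
      using l by (auto simp: Lam_def a_def)
    ultimately show ?case by simp
  qed
  then show "x = y" by blast
qed

section \<open>Eigenvectors and the bounded resolvent\<close>

text \<open>
  The eigenvector for \<open>1 / (m + 1)\<close>; it vanishes below \<open>m\<close> because the binomial coefficient does.
\<close>
definition eigen_seq :: "real \<Rightarrow> nat \<Rightarrow> cseq" where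
  "eigen_seq t m n = of_nat (n choose m) * of_real t ^ (n - m)"

text \<open>
  The powers of \<open>t\<close> combine to \<open>t\<^sup>n\<^sup>-\<^sup>m\<close> in every summand, and the hockey-stick identity sums the
  binomial coefficients.
\<close>

lemma geom_conv_eigen_seq:
  "geom_conv t (eigen_seq t m) n = of_nat (Suc n choose Suc m) * of_real t ^ (n - m)"
proof -
  have "of_real t ^ (n - k) * eigen_seq t m k = of_nat (k choose m) * of_real t ^ (n - m)"
    if "k \<le> n" for k
    using that by (cases "m \<le> k") (simp_all add: eigen_seq_def binomial_eq_0 flip: power_add)
  then have "geom_conv t (eigen_seq t m) n = (\<Sum>k\<le>n. of_nat (k choose m) * of_real t ^ (n - m))"
    by (simp add: geom_conv_def)
  also have "\<dots> = of_nat (\<Sum>k\<le>n. k choose m) * of_real t ^ (n - m)"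
    by (simp add: sum_distrib_right)
  finally show ?thesis by (simp only: sum_choose_upper)
qed

lemma cesaro_eigen_seq: "cesaro t (eigen_seq t m) n = 1 / of_nat (m + 1) * eigen_seq t m n"
proof -
  have "of_nat (Suc m) * of_nat (Suc n choose Suc m) = (of_nat (Suc n) * of_nat (n choose m) :: complex)"
    by (metis Suc_times_binomial_eq of_nat_mult mult.commute)
  then have "of_nat (Suc n choose Suc m) / of_nat (Suc n) = (of_nat (n choose m) / of_nat (Suc m) :: complex)"
    by (simp add: field_simps del: of_nat_Suc binomial_Suc_Suc)
  then show ?thesis
    unfolding cesaro_eq_geom_conv geom_conv_eigen_seq eigen_seq_def
    by (simp add: field_simps del: of_nat_Suc binomial_Suc_Suc)
qed

context shift_lattice
begin

lemma abs_seq_mem: "x \<in> X \<Longrightarrow> abs_seq x \<in> X"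
  and norm_abs_seq: "x \<in> X \<Longrightarrow> N (abs_seq x) \<le> N x"
  by (rule solid norm_solid, assumption, simp add: abs_seq_def)+

context
  fixes t :: real
  assumes t: "0 \<le> t" "t < 1"
begin

text \<open>
  By the formula for \<open>geom_conv t (eigen_seq t m)\<close>, each eigenvector arises from the preceding one by
  geometric convolution followed by a shift, and both preserve the space.
\<close>

lemma eigen_seq_mem: "eigen_seq t m \<in> X"
proof (induction m)
  case 0
  have "geom_conv t (unit_seq 0) n = (\<Sum>k\<le>n. if k = 0 then of_real t ^ n else 0)" for n
    unfolding geom_conv_def by (rule sum.cong) (auto simp: unit_seq_def)
  then have "eigen_seq t 0 = geom_conv t (unit_seq 0)"
    by (auto simp: eigen_seq_def fun_eq_iff)
  then show ?case using geom_conv_mem[OF t unit0] by simp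
next
  case (Suc m)
  have "eigen_seq t (Suc m) n = right_shift (geom_conv t (eigen_seq t m)) n" for n
    by (cases n) (simp_all add: geom_conv_eigen_seq eigen_seq_def del: binomial_Suc_Suc)
  then show ?case using shift[OF geom_conv_mem[OF t Suc]] by (simp add: ext)
qed

text \<open>
  With \<open>z = geom_conv t x\<close>, that is \<open>x = z - t S z\<close>, the equation becomes
  \<open>d n * z n + l * t * z (n - 1) = y n\<close> for \<open>d n = 1 / (n + 1) - l\<close>. This determines \<open>z\<close> recursively, and
  the weights \<open>\<bar>l * t / d n\<bar>\<close> tend to \<open>t\<close>, hence are eventually below any \<open>r > t\<close>.
\<close>

lemma solve_shift_cesaro:
  assumes l: "l \<noteq> 0" "l \<notin> Lam"
  shows "\<exists>C. \<forall>y\<in>X. \<exists>x\<in>X. shift_op (cesaro t) l x = y \<and> N x \<le> C * N y"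
proof -
  define d where "d n = 1 / of_nat (Suc n) - l" for n :: nat
  have d0: "d n \<noteq> 0" for n using l(2) by (auto simp: d_def Lam_def)
  have "(\<lambda>n. inverse (of_nat (Suc n))) \<longlonglongrightarrow> (0 :: complex)"
    using tendsto_of_real[OF LIMSEQ_inverse_real_of_nat, where 'a = complex]
    by (simp del: of_nat_Suc)
  then have "d \<longlonglongrightarrow> 0 - l"
    unfolding d_def inverse_eq_divide by (intro tendsto_intros)
  then have lim: "(\<lambda>n. inverse (d n)) \<longlonglongrightarrow> inverse (- l)"
    using l(1) by (intro tendsto_inverse) auto
  then have "Bseq (\<lambda>n. inverse (d n))"
    by (intro convergent_imp_Bseq convergentI)
  then obtain c where c: "c > 0" "\<And>n. cmod (inverse (d n)) \<le> c"
    unfolding Bseq_def by blast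
  define w where "w n = t * cmod l * cmod (inverse (d (Suc n)))" for n
  have "w \<longlonglongrightarrow> t * cmod l * cmod (inverse (- l))"
    unfolding w_def by (intro tendsto_intros LIMSEQ_Suc[OF lim])
  moreover have "t * cmod l * cmod (inverse (- l)) = t"
    using l(1) by (simp add: norm_inverse)
  ultimately have w_lim: "w \<longlonglongrightarrow> t" by (simp only:)
  \<comment> \<open>Any ratio strictly between \<open>t\<close> and 1 serves; \<open>t\<close> itself may be 0 or lie below all weights.\<close>
  define r where "r = (1 + t) / 2"
  have r: "0 < r" "0 \<le> r" "r < 1" "t < r" using t by (auto simp: r_def)
  have "\<forall>\<^sub>F n in sequentially. w n \<le> r"
    using order_tendstoD(2)[OF w_lim r(4)] by (rule eventually_mono) simp
  moreover have "0 \<le> w n" for n using t by (simp add: w_def)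
  ultimately obtain C where C: "0 \<le> C" "\<And>(z :: cseq) y n. cmod (z 0) \<le> c * cmod (y 0) \<Longrightarrow>
       (\<And>n. cmod (z (Suc n)) \<le> c * cmod (y (Suc n)) + w n * cmod (z n)) \<Longrightarrow>
       cmod (z n) \<le> C * cmod (geom_conv r (abs_seq y) n)"
    using dominated_by_geometric_sum[OF r(1), of w c] c(1) by (metis less_imp_le)
  have "\<exists>x\<in>X. shift_op (cesaro t) l x = y \<and> N x \<le> (2 * C / (1 - r)) * N y" if y: "y \<in> X" for y
  proof -
    define z where "z = rec_nat (y 0 / d 0) (\<lambda>n v. (y (Suc n) - l * of_real t * v) / d (Suc n))"
    have z0: "z 0 = y 0 / d 0" and z_Suc: "z (Suc n) = (y (Suc n) - l * of_real t * z n) / d (Suc n)" for n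
      by (simp_all add: z_def)
    have z_le: "cmod (z n) \<le> C * cmod (geom_conv r (abs_seq y) n)" for n
    proof (rule C(2))
      show "cmod (z 0) \<le> c * cmod (y 0)"
        using mult_right_mono[OF c(2)[of 0], of "cmod (y 0)"]
        by (simp add: z0 norm_divide norm_inverse divide_inverse norm_mult mult.commute)
      fix n
      have "cmod (z (Suc n)) = cmod (y (Suc n) - l * of_real t * z n) * cmod (inverse (d (Suc n)))"
        by (simp add: z_Suc divide_inverse norm_mult)
      also have "\<dots> \<le> (cmod (y (Suc n)) + cmod (l * of_real t * z n)) * cmod (inverse (d (Suc n)))"
        by (intro mult_right_mono norm_triangle_ineq4) simp
      also have "\<dots> = cmod (inverse (d (Suc n))) * cmod (y (Suc n)) + w n * cmod (z n)"
        using t by (simp add: w_def norm_mult algebra_simps)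
      also have "\<dots> \<le> c * cmod (y (Suc n)) + w n * cmod (z n)"
        by (intro add_right_mono mult_right_mono c) simp
      finally show "cmod (z (Suc n)) \<le> c * cmod (y (Suc n)) + w n * cmod (z n)" .
    qed
    let ?g = "geom_conv r (abs_seq y)"
    have g: "?g \<in> X" by (intro geom_conv_mem r abs_seq_mem y)
    have Ng: "N ?g \<le> N y / (1 - r)"
      using norm_geom_conv[OF r(2,3) abs_seq_mem[OF y]]
        divide_right_mono[OF norm_abs_seq[OF y], of "1 - r"] r(3) by linarith
    have z_le': "cmod (z n) \<le> cmod (of_real C * ?g n)" for n
      using z_le[of n] C(1) by (simp add: norm_mult)
    have zX: "z \<in> X" by (rule solid[OF scale[OF g] z_le'])
    have "N z \<le> N (\<lambda>n. of_real C * ?g n)" by (rule norm_solid[OF scale[OF g] z_le'])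
    also have "\<dots> = C * N ?g" using C(1) by (simp add: norm_scale g)
    also have "\<dots> \<le> C * (N y / (1 - r))" by (rule mult_left_mono[OF Ng C(1)])
    finally have Nz: "N z \<le> C * N y / (1 - r)" by simp
    define x where "x = (\<lambda>n. z n - of_real t * right_shift z n)"
    have gx: "geom_conv t x = z" unfolding x_def by (rule geom_conv_inverse)
    have xX: "x \<in> X" unfolding x_def by (intro diff scale shift zX)
    have "N x \<le> N z + N (\<lambda>n. of_real t * right_shift z n)"
      unfolding x_def by (intro norm_diff scale shift zX)
    also have "N (\<lambda>n. of_real t * right_shift z n) = t * N (right_shift z)"
      using t by (simp add: norm_scale shift zX)
    also have "\<dots> \<le> 1 * N z"
      using t by (intro mult_mono norm_shift zX norm_nonneg shift) auto
    finally have "N x \<le> 2 * (C * N y / (1 - r))" using Nz by simp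
    moreover have "shift_op (cesaro t) l x n = y n" for n
    proof (cases n)
      case 0
      have "d 0 * z 0 = y 0" using d0 by (simp add: z0)
      then show ?thesis using 0
        by (simp add: shift_op_def cesaro_eq_geom_conv gx d_def x_def algebra_simps)
    next
      case (Suc k)
      have "d n * z n = y n - l * of_real t * z k" using d0 by (simp add: Suc z_Suc)
      then show ?thesis
        unfolding shift_op_def cesaro_eq_geom_conv gx
        by (simp add: d_def x_def Suc algebra_simps del: of_nat_Suc)
    qed
    ultimately show ?thesis using xX by (intro bexI[of _ x]) auto
  qed
  then show ?thesis by blast
qed

lemma invertible_shift_cesaro:
  assumes "l \<noteq> 0" "l \<notin> Lam"
  shows "invertible_op X N (shift_op (cesaro t) l)"
proof -
  obtain C where "\<And>y. y \<in> X \<Longrightarrow> \<exists>x\<in>X. shift_op (cesaro t) l x = y \<and> N x \<le> C * N y"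
    using solve_shift_cesaro[OF assms] by blast
  then show ?thesis
    by (intro invertible_opI shift_cesaro_cont t inj_on_subset[OF inj_shift_cesaro[OF assms(2)]]) auto
qed

lemma Lam_not_inj:
  assumes "l \<in> Lam"
  shows "\<not> inj_on (shift_op (cesaro t) l) X"
proof
  obtain m where m: "l = 1 / of_nat (m + 1)" using assms by (auto simp: Lam_def)
  assume "inj_on (shift_op (cesaro t) l) X"
  moreover have "cesaro t (\<lambda>n. 0) = (\<lambda>n. 0)" by (simp add: cesaro_def fun_eq_iff)
  then have "shift_op (cesaro t) l (eigen_seq t m) = shift_op (cesaro t) l (\<lambda>n. 0)"
    by (auto simp: shift_op_def cesaro_eigen_seq m fun_eq_iff)
  ultimately have "eigen_seq t m = (\<lambda>n. 0)"
    using eigen_seq_mem zero by (auto dest: inj_onD)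
  then have "eigen_seq t m m = 0" by simp
  then show False by (simp add: eigen_seq_def)
qed

section \<open>The point zero of the spectrum\<close>

text \<open>
  The diagonal factor is inverted on a finitely supported sequence without leaving the space, and
  then \<open>geom_conv t\<close> is inverted by \<open>I - t S\<close>.
\<close>

lemma finite_support_in_range_cesaro:
  assumes "finite A"
  shows "restr A y \<in> cesaro t ` X"
proof -
  define g where "g = restr A (\<lambda>n. of_nat (Suc n) * y n)"
  define x where "x = (\<lambda>n. g n - of_real t * right_shift g n)"
  have "g \<in> X" unfolding g_def using assms by (rule restr_finite_mem)
  then have "x \<in> X" unfolding x_def by (intro diff scale shift)
  moreover have "geom_conv t x = g" unfolding x_def by (rule geom_conv_inverse)
  then have "cesaro t x = restr A y"
    by (auto simp: cesaro_eq_geom_conv g_def restr_def fun_eq_iff simp del: of_nat_Suc)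
  ultimately show ?thesis by (metis imageI)
qed

lemma range_cesaro_dense: "norm_top X N closure_of (cesaro t ` X) = X"
proof -
  have "\<exists>y\<in>cesaro t ` X. y \<in> M.mball x r" if x: "x \<in> X" and r: "r > 0" for x r
  proof -
    obtain m where m: "N (restr {m..} x) < r"
      using order_tendstoD(2)[OF tail[OF x] r] by (auto simp: eventually_sequentially)
    have "(\<lambda>n. x n - restr {..<m} x n) = restr {m..} x"
      by (auto simp: restr_def)
    then have "restr {..<m} x \<in> M.mball x r"
      using m x by (simp add: M.in_mball seq_dist_def restr_mem)
    then show ?thesis using finite_support_in_range_cesaro[of "{..<m}" x] by blast
  qed
  then show ?thesis
    unfolding norm_top_def M.metric_closure_of by blast
qed

end

text \<open>
  The sequence \<open>y\<close> is supported on the indices \<open>k j = 2 ^ j - 1\<close> and has the value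
  \<open>1 / ((k j + 1) * N (unit_seq (k j)))\<close> there. Its pieces have norm \<open>2 ^ (- j)\<close>, so that their series
  converges absolutely. Multiplication by \<open>n + 1\<close> turns each piece into one of norm 1, so that the tails
  of the product do not tend to zero.
\<close>

lemma lacunary_not_divisible:
  obtains y where "y \<in> X" "(\<lambda>n. of_nat (Suc n) * y n) \<notin> X"
proof -
  define k where "k j = 2 ^ j - (1 :: nat)" for j
  have k_Suc: "Suc (k j) = 2 ^ j" for j by (simp add: k_def)
  have k_eq: "k i = k j \<longleftrightarrow> i = j" for i j
    using k_Suc[of i] k_Suc[of j] by (metis numeral_One one_less_numeral_iff power_inject_exp semiring_norm(76))
  have k_ge: "j \<le> k j" for j
    using less_exp[of j] k_Suc[of j] by linarith
  define f where "f j = (\<lambda>n. of_real (1 / (2 ^ j * N (unit_seq (k j)))) * unit_seq (k j) n)" for j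
  define y where "y n = (\<Sum>j\<le>n. f j n)" for n
  have f: "f j \<in> X" for j unfolding f_def by (intro scale unit_mem)
  have "N (f j) = (1 / 2) ^ j" for j
    using norm_unit_pos[of "k j"]
    by (simp only: f_def norm_scale[OF unit_mem] norm_of_real) (simp add: field_simps)
  then have s: "summable (\<lambda>j. N (f j))" by (simp add: summable_geometric)
  have "f j n = 0" if "j \<notin> {..n}" for j n
    using k_ge[of j] that by (simp add: f_def unit_seq_def)
  then have "(\<lambda>j. f j n) sums y n" for n
    unfolding y_def by (intro sums_finite) auto
  from absolutely_convergent_series(1)[OF f s this] have yX: "y \<in> X" .
  have "y (k j) = 1 / (2 ^ j * of_real (N (unit_seq (k j))))" for j
  proof -
    have "y (k j) = (\<Sum>i\<le>k j. if i = j then of_real (1 / (2 ^ j * N (unit_seq (k j)))) else 0)"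
      unfolding y_def by (rule sum.cong) (auto simp: f_def unit_seq_def k_eq eq_commute)
    then show ?thesis using k_ge[of j] by simp
  qed
  then have yk: "of_nat (Suc (k j)) * y (k j) = 1 / of_real (N (unit_seq (k j)))" for j
    by (simp add: k_Suc del: of_nat_Suc)
  define g where "g = (\<lambda>n. of_nat (Suc n) * y n)"
  have "g \<notin> X"
  proof
    assume gX: "g \<in> X"
    obtain m where m: "N (restr {m..} g) < 1"
      using order_tendstoD(2)[OF tail[OF gX], of 1] by (auto simp: eventually_sequentially)
    define c :: complex where "c = 1 / of_real (N (unit_seq (k m)))"
    have "N (\<lambda>n. c * unit_seq (k m) n) \<le> N (restr {m..} g)"
    proof (rule norm_solid[OF restr_mem[OF gX]])
      show "cmod (c * unit_seq (k m) n) \<le> cmod (restr {m..} g n)" for n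
        using yk[of m] k_ge[of m] by (simp add: unit_seq_def restr_def g_def c_def del: of_nat_Suc)
    qed
    also have "N (\<lambda>n. c * unit_seq (k m) n) = cmod c * N (unit_seq (k m))"
      by (rule norm_scale[OF unit_mem])
    also have "\<dots> = 1"
      using norm_unit_pos[of "k m"] by (simp add: c_def norm_divide)
    finally show False using m by simp
  qed
  then show ?thesis using that[OF yX] by (simp add: g_def)
qed

section \<open>Spectra in a solid sequence space\<close>

lemma cesaro_spectra:
  assumes t: "0 \<le> t" "t < 1"
  shows "spectrum_op X N (cesaro t) = Lam \<union> {0}"
    and "point_spectrum X (cesaro t) = Lam"
    and "continuous_spectrum X N (cesaro t) = {0}"
    and "residual_spectrum X N (cesaro t) = {}"
proof -
  have Lam0: "0 \<notin> Lam" by (auto simp: Lam_def simp del: of_nat_add of_nat_Suc)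
  have inj: "inj_on (shift_op (cesaro t) l) X \<longleftrightarrow> l \<notin> Lam" for l
    using Lam_not_inj[OF t] inj_on_subset[OF inj_shift_cesaro] by blast
  have shift0: "shift_op (cesaro t) 0 = cesaro t" by (simp add: shift_op_def fun_eq_iff)
  have not_onto: "cesaro t ` X \<noteq> X"
  proof
    assume onto: "cesaro t ` X = X"
    obtain y where y: "y \<in> X" "(\<lambda>n. of_nat (Suc n) * y n) \<notin> X" by (rule lacunary_not_divisible)
    obtain x where x: "x \<in> X" "y = cesaro t x" using y(1) onto by blast
    have "(\<lambda>n. of_nat (Suc n) * y n) = geom_conv t x"
      by (simp add: x cesaro_eq_geom_conv del: of_nat_Suc)
    then show False using y(2) geom_conv_mem[OF t x(1)] by simp
  qed
  have inv_onto: "shift_op (cesaro t) l ` X = X"  "inj_on (shift_op (cesaro t) l) X"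
    if inv: "invertible_op X N (shift_op (cesaro t) l)" for l
  proof -
    obtain S where S: "S \<in> cont_linear_ops X N"
      "\<And>x. x \<in> X \<Longrightarrow> S (shift_op (cesaro t) l x) = x \<and> shift_op (cesaro t) l (S x) = x"
      using inv unfolding invertible_op_def by blast
    have "shift_op (cesaro t) l \<in> linear_ops X" "S \<in> linear_ops X"
      using that S(1) by (auto simp: invertible_op_def cont_linear_ops_def)
    then have "\<And>x. x \<in> X \<Longrightarrow> shift_op (cesaro t) l x \<in> X" "\<And>x. x \<in> X \<Longrightarrow> S x \<in> X"
      by (auto simp: linear_ops_def)
    then show "shift_op (cesaro t) l ` X = X"
      using S(2) by (metis (no_types, lifting) image_eqI image_subsetI subsetI subset_antisym)
    show "inj_on (shift_op (cesaro t) l) X" using S(2) by (metis inj_onI)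
  qed
  have inv: "invertible_op X N (shift_op (cesaro t) l) \<longleftrightarrow> l \<notin> Lam \<union> {0}" for l
  proof
    assume i: "invertible_op X N (shift_op (cesaro t) l)"
    have "l \<notin> Lam" using inv_onto(2)[OF i] inj by blast
    moreover have "l \<noteq> 0" using inv_onto(1)[OF i] not_onto shift0 by metis
    ultimately show "l \<notin> Lam \<union> {0}" by blast
  qed (use invertible_shift_cesaro[OF t] in blast)
  show "spectrum_op X N (cesaro t) = Lam \<union> {0}"
    unfolding spectrum_op_def using inv by blast
  show "point_spectrum X (cesaro t) = Lam"
    unfolding point_spectrum_def using inj by blast
  have X_closure: "norm_top X N closure_of X = X"
    using closure_of_topspace[of "norm_top X N"] by (simp add: norm_top_def)
  have onto: "shift_op (cesaro t) l ` X = X" if "l \<notin> Lam" "l \<noteq> 0" for l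
    using inv_onto inv that by blast
  show "continuous_spectrum X N (cesaro t) = {0}"
    unfolding continuous_spectrum_def
    using inj onto not_onto range_cesaro_dense[OF t] Lam0 shift0 by auto
  show "residual_spectrum X N (cesaro t) = {}"
    unfolding residual_spectrum_def
    using inj onto range_cesaro_dense[OF t] X_closure shift0 by fastforce
qed

end

section \<open>Spaces of sequences with controlled averages\<close>

definition average :: "cseq \<Rightarrow> cseq" where
  "average x = cesaro 1 (abs_seq x)"

lemma average_eq: "average x n = of_real ((\<Sum>k\<le>n. cmod (x k)) / real (Suc n))"
  by (simp add: average_def cesaro_def abs_seq_def)

lemma cmod_average: "cmod (average x n) = (\<Sum>k\<le>n. cmod (x k)) / real (Suc n)"
  unfolding average_eq norm_of_real by (simp add: sum_nonneg del: of_nat_Suc)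

text \<open>
  Averaging commutes with shifts and truncations up to inequalities in the right direction: the
  averages of the shifted sequence are at most the shifted averages, and the averages of a tail vanish
  before the tail starts. The harmonic sequence is the average of \<open>unit_seq 0\<close>, and its multiples
  dominate the averages of every finitely supported sequence.
\<close>

lemma (in shift_lattice) shift_lattice_average:
  assumes harmonic: "(\<lambda>n. 1 / of_nat (Suc n)) \<in> X"
  shows "shift_lattice {x. average x \<in> X} (\<lambda>x. N (average x))"
proof -
  have mono: "cmod (average x n) \<le> cmod (average y n)" if "\<And>k. k \<le> n \<Longrightarrow> cmod (x k) \<le> cmod (y k)" for x y n
    unfolding cmod_average by (intro divide_right_mono sum_mono that) auto
  have cmod_add: "cmod (average x n + average y n) = cmod (average x n) + cmod (average y n)" for x y n
    unfolding average_eq of_real_add[symmetric] norm_of_real by (simp add: sum_nonneg del: of_nat_Suc)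
  have add_le: "cmod (average (\<lambda>n. x n + y n) n) \<le> cmod (average x n + average y n)" for x y n
    unfolding cmod_add unfolding cmod_average add_divide_distrib[symmetric] sum.distrib[symmetric]
    by (intro divide_right_mono sum_mono norm_triangle_ineq) auto
  have scale_eq: "average (\<lambda>n. c * x n) = (\<lambda>n. of_real (cmod c) * average x n)" for c x
    by (simp add: average_eq norm_mult sum_distrib_left fun_eq_iff)
  have shift_le: "cmod (average (right_shift x) n) \<le> cmod (right_shift (average x) n)" for x n
  proof (cases n)
    case (Suc k)
    have "(\<Sum>i\<le>k. cmod (x i)) / real (Suc (Suc k)) \<le> (\<Sum>i\<le>k. cmod (x i)) / real (Suc k)"
      by (intro divide_left_mono sum_nonneg) auto
    then show ?thesis
      by (simp add: Suc cmod_average sum.atMost_Suc_shift del: sum.atMost_Suc of_nat_Suc)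
  qed (simp add: cmod_average)
  have tail_le: "cmod (average (restr {m..} x) n) \<le> cmod (restr {m..} (average x) n)" for m x n
  proof (cases "m \<le> n")
    case True
    then show ?thesis using mono[of n "restr {m..} x" x] by (simp add: restr_def)
  qed (simp add: cmod_average restr_def)
  have finite_mem: "average (restr A x) \<in> X" if "finite A" for A x
  proof (rule solid[OF scale[OF harmonic]])
    fix n
    have "(\<Sum>k\<le>n. cmod (restr A x k)) = (\<Sum>k\<in>{..n} \<inter> A. cmod (x k))"
      by (rule sum.mono_neutral_cong_right) (auto simp: restr_def)
    also have "\<dots> \<le> (\<Sum>k\<in>A. cmod (x k))" by (rule sum_mono2) (use that in auto)
    finally have "cmod (average (restr A x) n) \<le> (\<Sum>k\<in>A. cmod (x k)) / real (Suc n)"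
      unfolding cmod_average by (rule divide_right_mono) simp
    also have "\<dots> = cmod (of_real (\<Sum>k\<in>A. cmod (x k)) * (1 / of_nat (Suc n)))"
      by (simp add: norm_mult norm_divide sum_nonneg del: of_nat_Suc of_real_sum)
    finally show "cmod (average (restr A x) n) \<le>
      cmod (of_real (\<Sum>k\<in>A. cmod (x k)) * (1 / of_nat (Suc n)))" .
  qed
  show ?thesis
  proof
    fix x y assume xy: "x \<in> {x. average x \<in> X}" "y \<in> {x. average x \<in> X}"
    then have s: "(\<lambda>n. average x n + average y n) \<in> X" by (auto intro: add)
    show "(\<lambda>n. x n + y n) \<in> {x. average x \<in> X}" using solid[OF s add_le] by simp
    show "N (average (\<lambda>n. x n + y n)) \<le> N (average x) + N (average y)"
      using norm_solid[OF s add_le] norm_add[of "average x" "average y"] xy by simp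
  next
    fix x c assume "x \<in> {x. average x \<in> X}"
    then show "(\<lambda>n. c * x n) \<in> {x. average x \<in> X}" "N (average (\<lambda>n. c * x n)) = cmod c * N (average x)"
      by (simp_all add: scale_eq scale norm_scale)
  next
    fix x y assume "y \<in> {x. average x \<in> X}" "\<And>n. cmod (x n) \<le> cmod (y n)"
    then show "x \<in> {x. average x \<in> X}" "N (average x) \<le> N (average y)"
      using solid[of "average y" "average x"] norm_solid[of "average y" "average x"] mono[of _ x y] by auto
  next
    have "(\<Sum>k\<le>n. cmod (unit_seq 0 k)) = 1" for n
      by (induction n) (simp_all add: unit_seq_def)
    then have "average (unit_seq 0) = (\<lambda>n. 1 / of_nat (Suc n))"
      by (simp add: average_eq fun_eq_iff)
    then show "unit_seq 0 \<in> {x. average x \<in> X}" using harmonic by simp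
  next
    fix x assume "x \<in> {x. average x \<in> X}"
    then have x: "average x \<in> X" by simp
    show "right_shift x \<in> {x. average x \<in> X}" using solid[OF shift[OF x] shift_le] by simp
    show "N (average (right_shift x)) \<le> N (average x)"
      using norm_solid[OF shift[OF x] shift_le] norm_shift[OF x] by linarith
    show "(\<lambda>m. N (average (restr {m..} x))) \<longlonglongrightarrow> 0"
    proof (rule tendsto_sandwich[OF _ _ tendsto_const tail[OF x]])
      have r: "restr {m..} (average x) \<in> X" for m by (rule restr_mem[OF x])
      show "\<forall>\<^sub>F m in sequentially. N (average (restr {m..} x)) \<le> N (restr {m..} (average x))"
        using norm_solid[OF r tail_le] by simp
      show "\<forall>\<^sub>F m in sequentially. 0 \<le> N (average (restr {m..} x))"
        using norm_nonneg[OF solid[OF r tail_le]] by simp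
    qed
  next
    fix n
    obtain K where K: "K \<ge> 0" "\<And>x. x \<in> X \<Longrightarrow> cmod (x n) \<le> K * N x" using coord by blast
    have "cmod (x n) \<le> real (Suc n) * K * N (average x)" if "average x \<in> X" for x
    proof -
      have "cmod (x n) \<le> (\<Sum>k\<le>n. cmod (x k))" by (rule member_le_sum) auto
      also have "\<dots> = real (Suc n) * cmod (average x n)" by (simp add: cmod_average del: of_nat_Suc)
      also have "\<dots> \<le> real (Suc n) * (K * N (average x))"
        by (intro mult_left_mono K(2) that) simp
      finally show ?thesis by simp
    qed
    then show "\<exists>K\<ge>0. \<forall>x\<in>{x. average x \<in> X}. cmod (x n) \<le> K * N (average x)"
      using K(1) by (intro exI[of _ "real (Suc n) * K"]) auto
  next
    fix x
    assume cau: "\<And>\<epsilon>. \<epsilon> > 0 \<Longrightarrow> \<exists>m. \<forall>n. N (average (restr {m..<n} x)) \<le> \<epsilon>"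
    have "average x \<in> X"
    proof (rule Cauchy_truncations)
      fix \<epsilon> :: real assume "\<epsilon> > 0"
      then obtain m where m: "\<And>n. N (average (restr {m..<n} x)) \<le> \<epsilon>/2"
        using cau[of "\<epsilon>/2"] by auto
      \<comment> \<open>The head of \<open>x\<close> keeps contributing to all later averages, but its averages lie in \<open>X\<close>.\<close>
      define v where "v = average (restr {..<m} x)"
      have v: "v \<in> X" unfolding v_def by (rule finite_mem) simp
      from order_tendstoD(2)[OF tail[OF v], of "\<epsilon>/2"] obtain l where l: "N (restr {l..} v) < \<epsilon>/2"
        using \<open>\<epsilon> > 0\<close> by (auto simp: eventually_sequentially)
      have "N (restr {l..<n} (average x)) \<le> \<epsilon>" for n
      proof -
        let ?w = "average (restr {m..<n} x)"
        have w: "?w \<in> X" by (rule finite_mem) simp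
        have "cmod (restr {l..<n} (average x) i) \<le> cmod (restr {l..} v i + ?w i)" for i
        proof (cases "l \<le> i \<and> i < n")
          case True
          have "cmod (average x i) \<le> cmod (average (\<lambda>n'. restr {..<m} x n' + restr {m..<n} x n') i)"
            by (rule mono) (use True in \<open>auto simp: restr_def\<close>)
          also have "\<dots> \<le> cmod (v i + ?w i)" unfolding v_def by (rule add_le)
          finally show ?thesis using True by (simp add: restr_def)
        qed (auto simp: restr_def)
        then have "N (restr {l..<n} (average x)) \<le> N (\<lambda>i. restr {l..} v i + ?w i)"
          by (intro norm_solid add restr_mem v w)
        also have "\<dots> \<le> N (restr {l..} v) + N ?w" by (intro norm_add restr_mem v w)
        finally show ?thesis using l m[of n] by simp
      qed
      then show "\<exists>m. \<forall>n. N (restr {m..<n} (average x)) \<le> \<epsilon>" by blast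
    qed
    then show "x \<in> {x. average x \<in> X}" by simp
  qed
qed

section \<open>The spaces of p-summable sequences and of null sequences\<close>

lemma powr_convex_comb:
  fixes p u v a b :: real
  assumes p: "1 \<le> p" and uv: "0 \<le> u" "0 \<le> v" and ab: "0 \<le> a" "0 \<le> b" "a + b = 1"
  shows "(a * u + b * v) powr p \<le> a * u powr p + b * v powr p"
proof -
  have zero: "(c * w) powr p \<le> c * w powr p" if "0 \<le> c" "c \<le> 1" "0 \<le> w" for c w :: real
  proof -
    have "c powr p \<le> c" using powr_mono'[of 1 p c] that p by simp
    then show ?thesis using that by (simp add: powr_mult mult_right_mono)
  qed
  have a: "a = 1 - b" "b \<le> 1" using ab by simp_all
  consider "u = 0" | "v = 0" | "u > 0" "v > 0" using uv by linarith
  then show ?thesis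
  proof cases
    case 3
    then show ?thesis
      using convex_onD[OF powr_convex[OF p], of b u v] ab(2) a by simp
  qed (use zero[of a u] zero[of b v] ab uv p in simp_all)
qed

lemma lp_norm_nonneg: "0 \<le> lp_norm p x"
  by (simp add: lp_norm_def)

lemma lp_norm_powr:
  assumes "0 < p" "x \<in> lp_space p"
  shows "lp_norm p x powr p = (\<Sum>n. cmod (x n) powr p)"
  using assms by (simp add: lp_norm_def powr_powr suminf_nonneg lp_space_def)

lemma lp_norm_le_iff:
  assumes "0 < p" "x \<in> lp_space p" "0 \<le> B"
  shows "lp_norm p x \<le> B \<longleftrightarrow> (\<Sum>n. cmod (x n) powr p) \<le> B powr p"
  unfolding lp_norm_powr[OF assms(1,2), symmetric]
proof
  show "lp_norm p x powr p \<le> B powr p" if "lp_norm p x \<le> B"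
    using assms(1) that lp_norm_nonneg by (intro powr_mono2) auto
  show "lp_norm p x \<le> B" if "lp_norm p x powr p \<le> B powr p"
    using powr_less_mono2[OF assms(1,3), of "lp_norm p x"] that by linarith
qed

lemma cmod_le_lp_norm:
  assumes "0 < p" "x \<in> lp_space p"
  shows "cmod (x n) \<le> lp_norm p x"
proof (rule ccontr)
  assume "\<not> ?thesis"
  then have "lp_norm p x powr p < cmod (x n) powr p"
    using assms(1) by (intro powr_less_mono2) (auto simp: lp_norm_nonneg)
  also have "\<dots> \<le> (\<Sum>n. cmod (x n) powr p)"
    using sum_le_suminf[of "\<lambda>n. cmod (x n) powr p" "{n}"] assms(2) by (simp add: lp_space_def)
  finally show False using assms by (simp add: lp_norm_powr)
qed

text \<open>
  For norms \<open>a\<close> and \<open>b\<close> of \<open>x\<close> and \<open>y\<close>, the normalised sum \<open>(\<bar>x n\<bar> + \<bar>y n\<bar>) / (a + b)\<close> is the convex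
  combination of \<open>\<bar>x n\<bar> / a\<close> and \<open>\<bar>y n\<bar> / b\<close> with weights \<open>a / (a + b)\<close> and \<open>b / (a + b)\<close>. Convexity of
  the power function bounds its \<open>p\<close>-th power by a series that sums to 1.
\<close>

lemma Minkowski:
  assumes p: "1 \<le> p" and xy: "x \<in> lp_space p" "y \<in> lp_space p"
  shows "(\<lambda>n. x n + y n) \<in> lp_space p"
    and "lp_norm p (\<lambda>n. x n + y n) \<le> lp_norm p x + lp_norm p y"
proof -
  have p0: "0 < p" using p by simp
  define a b where "a = lp_norm p x" and "b = lp_norm p y"
  have *: "(\<lambda>n. x n + y n) \<in> lp_space p \<and> lp_norm p (\<lambda>n. x n + y n) \<le> a + b"
  proof (cases "a = 0 \<or> b = 0")
    case True
    then have "x = (\<lambda>n. 0) \<or> y = (\<lambda>n. 0)"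
      using cmod_le_lp_norm[OF p0 xy(1)] cmod_le_lp_norm[OF p0 xy(2)] by (auto simp: a_def b_def fun_eq_iff)
    then show ?thesis using xy lp_norm_nonneg[of p x] lp_norm_nonneg[of p y] by (auto simp: a_def b_def)
  next
    case False
    then have ab: "0 < a" "0 < b"
      using lp_norm_nonneg[of p x] lp_norm_nonneg[of p y] by (auto simp: a_def b_def less_le)
    define h where "h n = (a + b) powr p *
      (a / (a + b) * (cmod (x n) powr p / a powr p) + b / (a + b) * (cmod (y n) powr p / b powr p))" for n
    have sx: "(\<lambda>n. cmod (x n) powr p) sums (a powr p)" "(\<lambda>n. cmod (y n) powr p) sums (b powr p)"
      using xy by (simp_all add: a_def b_def lp_norm_powr[OF p0] lp_space_def summable_sums)
    have "h sums ((a + b) powr p * (a / (a + b) * (a powr p / a powr p) + b / (a + b) * (b powr p / b powr p)))"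
      unfolding h_def by (intro sums_mult sums_add sums_divide sx)
    also have "a / (a + b) * (a powr p / a powr p) + b / (a + b) * (b powr p / b powr p) = 1"
      using ab by (simp add: add_divide_distrib[symmetric])
    finally have h: "h sums ((a + b) powr p)" by simp
    have le: "cmod (x n + y n) powr p \<le> h n" for n
    proof -
      have "cmod (x n + y n) \<le> (a + b) * (a / (a + b) * (cmod (x n) / a) + b / (a + b) * (cmod (y n) / b))"
        using ab norm_triangle_ineq[of "x n" "y n"] by (simp add: distrib_left add_pos_pos less_imp_neq[symmetric])
      then have "cmod (x n + y n) powr p \<le>
          ((a + b) * (a / (a + b) * (cmod (x n) / a) + b / (a + b) * (cmod (y n) / b))) powr p"
        using p0 by (intro powr_mono2) auto
      also have "\<dots> = (a + b) powr p * (a / (a + b) * (cmod (x n) / a) + b / (a + b) * (cmod (y n) / b)) powr p"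
        by (rule powr_mult)
      also have "\<dots> \<le> (a + b) powr p *
          (a / (a + b) * (cmod (x n) / a) powr p + b / (a + b) * (cmod (y n) / b) powr p)"
        using ab by (intro mult_left_mono powr_convex_comb p) (auto simp: add_divide_distrib[symmetric])
      also have "\<dots> = h n" using ab by (simp add: h_def powr_divide)
      finally show ?thesis .
    qed
    have mem: "(\<lambda>n. x n + y n) \<in> lp_space p"
      unfolding lp_space_def using le
      by (auto intro!: summable_comparison_test'[OF sums_summable[OF h], of 0])
    moreover have "(\<Sum>n. cmod (x n + y n) powr p) \<le> (a + b) powr p"
      using suminf_le[OF le _ sums_summable[OF h]] mem sums_unique[OF h] by (simp add: lp_space_def)
    ultimately show ?thesis using ab by (simp add: lp_norm_le_iff[OF p0])
  qed
  then show "(\<lambda>n. x n + y n) \<in> lp_space p" "lp_norm p (\<lambda>n. x n + y n) \<le> lp_norm p x + lp_norm p y"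
    by (simp_all add: a_def b_def)
qed

lemma shift_lattice_lp:
  assumes p: "1 \<le> p"
  shows "shift_lattice (lp_space p) (lp_norm p)"
proof
  have p0: "0 < p" using p by simp
  show "(\<lambda>n. x n + y n) \<in> lp_space p" "lp_norm p (\<lambda>n. x n + y n) \<le> lp_norm p x + lp_norm p y"
    if "x \<in> lp_space p" "y \<in> lp_space p" for x y
    using Minkowski[OF p that] .
  show "(\<lambda>n. c * x n) \<in> lp_space p" "lp_norm p (\<lambda>n. c * x n) = cmod c * lp_norm p x"
    if "x \<in> lp_space p" for x c
    using that p0
    by (simp_all add: lp_space_def lp_norm_def norm_mult powr_mult summable_mult suminf_mult suminf_nonneg powr_powr)
  show solid: "x \<in> lp_space p" and "lp_norm p x \<le> lp_norm p y"
    if y: "y \<in> lp_space p" and le: "\<And>n. cmod (x n) \<le> cmod (y n)" for x y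
  proof -
    have le': "cmod (x n) powr p \<le> cmod (y n) powr p" for n
      using p0 le by (intro powr_mono2) auto
    show x: "x \<in> lp_space p"
      using y le' unfolding lp_space_def by (auto intro: summable_comparison_test'[of _ 0])
    show "lp_norm p x \<le> lp_norm p y"
      using suminf_le[OF le'] x y
      by (simp add: lp_norm_le_iff[OF p0 x lp_norm_nonneg] lp_norm_powr[OF p0 y] lp_space_def)
  qed
  have finite_supp: "restr A x \<in> lp_space p \<and> (\<Sum>n. cmod (restr A x n) powr p) = (\<Sum>n\<in>A. cmod (x n) powr p)"
    if "finite A" for A x
  proof -
    have "(\<lambda>n. cmod (restr A x n) powr p) sums (\<Sum>n\<in>A. cmod (restr A x n) powr p)"
      using that by (intro sums_finite) (auto simp: restr_def)
    also have "(\<Sum>n\<in>A. cmod (restr A x n) powr p) = (\<Sum>n\<in>A. cmod (x n) powr p)"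
      by (simp add: restr_def)
    finally show ?thesis by (auto simp: lp_space_def sums_iff)
  qed
  have "unit_seq 0 = restr {0} (\<lambda>n. 1)" by (auto simp: unit_seq_def restr_def)
  then show "unit_seq 0 \<in> lp_space p" using finite_supp[of "{0}"] by simp
  show "right_shift x \<in> lp_space p" and "lp_norm p (right_shift x) \<le> lp_norm p x"
    if x: "x \<in> lp_space p" for x
  proof -
    show m: "right_shift x \<in> lp_space p"
      using x unfolding lp_space_def by (subst mem_Collect_eq, subst summable_Suc_iff[symmetric]) simp
    show "lp_norm p (right_shift x) \<le> lp_norm p x"
      using suminf_split_head[of "\<lambda>n. cmod (right_shift x n) powr p"] m
      by (simp add: lp_norm_def lp_space_def)
  qed
  show "\<exists>K\<ge>0. \<forall>x\<in>lp_space p. cmod (x n) \<le> K * lp_norm p x" for n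
    using cmod_le_lp_norm[OF p0] by (intro exI[of _ 1]) auto
  show "(\<lambda>m. lp_norm p (restr {m..} x)) \<longlonglongrightarrow> 0" if x: "x \<in> lp_space p" for x
  proof -
    define f where "f n = cmod (x n) powr p" for n
    have f: "summable f" using x by (simp add: lp_space_def f_def[abs_def])
    have "(\<Sum>n. cmod (restr {m..} x n) powr p) = (\<Sum>n. f (n + m))" for m
    proof -
      have "restr {m..} x \<in> lp_space p" by (rule solid[OF x]) (simp add: restr_def)
      then show ?thesis
        using suminf_split_initial_segment[of "\<lambda>n. cmod (restr {m..} x n) powr p" m]
        by (simp add: lp_space_def restr_def f_def)
    qed
    then have "lp_norm p (restr {m..} x) = (\<Sum>n. f (n + m)) powr (1 / p)" for m
      by (simp add: lp_norm_def)
    moreover have "(\<lambda>m. (\<Sum>n. f (n + m)) powr (1 / p)) \<longlonglongrightarrow> 0 powr (1 / p)"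
    proof (rule tendsto_powr'[OF suminf_exist_split2[OF f] tendsto_const])
      have "0 \<le> (\<Sum>n. f (n + m))" for m
        using f by (intro suminf_nonneg) (simp_all add: summable_iff_shift, simp add: f_def)
      then show "0 \<noteq> (0::real) \<or> 0 < 1 / p \<and> (\<forall>\<^sub>F m in sequentially. 0 \<le> (\<Sum>n. f (n + m)))"
        using p0 by simp
    qed
    ultimately show ?thesis by simp
  qed
  show "x \<in> lp_space p"
    if cau: "\<And>\<epsilon>. \<epsilon> > 0 \<Longrightarrow> \<exists>m. \<forall>n. lp_norm p (restr {m..<n} x) \<le> \<epsilon>" for x
  proof -
    obtain m where m: "\<And>n. lp_norm p (restr {m..<n} x) \<le> 1" using cau[of 1] by auto
    have "(\<Sum>i<n. cmod (x (i + m)) powr p) \<le> 1" for n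
    proof -
      have "(\<Sum>i<n. cmod (x (i + m)) powr p) = (\<Sum>i=m..<n+m. cmod (x i) powr p)"
        using sum.shift_bounds_nat_ivl[of "\<lambda>i. cmod (x i) powr p" 0 m n] by (simp add: atLeast0LessThan)
      also have "\<dots> \<le> 1"
        using m[of "n + m"] finite_supp[of "{m..<n+m}" x] by (simp add: lp_norm_le_iff[OF p0])
      finally show ?thesis .
    qed
    then have "summable (\<lambda>i. cmod (x (i + m)) powr p)"
      by (intro summableI_nonneg_bounded) auto
    then show ?thesis
      by (simp add: lp_space_def summable_iff_shift[of "\<lambda>i. cmod (x i) powr p"])
  qed
qed

lemma harmonic_mem_lp: "1 < p \<Longrightarrow> (\<lambda>n. 1 / of_nat (Suc n)) \<in> lp_space p"
proof -
  assume p: "1 < p"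
  then have "summable (\<lambda>n. real n powr (- p))" by (simp add: summable_real_powr_iff)
  then have "summable (\<lambda>n. real (Suc n) powr (- p))" by (rule summable_Suc_iff[THEN iffD2])
  then show ?thesis
    by (simp add: lp_space_def norm_divide powr_divide powr_minus_divide del: of_nat_Suc)
qed

lemma cmod_le_sup_norm: "x \<in> c0_space \<Longrightarrow> cmod (x n) \<le> sup_norm x"
  unfolding sup_norm_def
proof (rule cSUP_upper)
  assume "x \<in> c0_space"
  then have "Bseq x" by (auto simp: c0_space_def intro: convergent_imp_Bseq convergentI)
  then show "bdd_above (range (\<lambda>n. cmod (x n)))"
    by (auto simp: Bseq_def bdd_above_def)
qed simp

lemma sup_norm_le: "(\<And>n. cmod (x n) \<le> B) \<Longrightarrow> sup_norm x \<le> B"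
  unfolding sup_norm_def by (rule cSUP_least) auto

lemma shift_lattice_c0: "shift_lattice c0_space sup_norm"
proof
  show "(\<lambda>n. x n + y n) \<in> c0_space" if "x \<in> c0_space" "y \<in> c0_space" for x y
    using that unfolding c0_space_def by (auto intro: tendsto_add_zero)
  show "sup_norm (\<lambda>n. x n + y n) \<le> sup_norm x + sup_norm y" if "x \<in> c0_space" "y \<in> c0_space" for x y
    by (rule sup_norm_le)
       (use cmod_le_sup_norm[OF that(1)] cmod_le_sup_norm[OF that(2)] in \<open>blast intro: order.trans[OF norm_triangle_ineq] add_mono\<close>)
  show scale: "(\<lambda>n. c * x n) \<in> c0_space" if "x \<in> c0_space" for x c
    using that unfolding c0_space_def by (auto intro: tendsto_mult_right_zero)
  have le: "sup_norm (\<lambda>n. c * x n) \<le> cmod c * sup_norm x" if "x \<in> c0_space" for x c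
    by (rule sup_norm_le) (auto simp: norm_mult intro!: mult_left_mono cmod_le_sup_norm that)
  show "sup_norm (\<lambda>n. c * x n) = cmod c * sup_norm x" if x: "x \<in> c0_space" for x c
  proof (cases "c = 0")
    case True
    then show ?thesis by (simp add: sup_norm_def)
  next
    case False
    then have "sup_norm x \<le> inverse (cmod c) * sup_norm (\<lambda>n. c * x n)"
      using le[OF scale[OF x, of c], of "inverse c"] by (simp add: norm_inverse flip: mult.assoc)
    then have "cmod c * sup_norm x \<le> sup_norm (\<lambda>n. c * x n)" using False by (simp add: field_simps)
    then show ?thesis using le[OF x, of c] by simp
  qed
  show "x \<in> c0_space" if "y \<in> c0_space" "\<And>n. cmod (x n) \<le> cmod (y n)" for x y
    using that unfolding c0_space_def
    by (auto intro: Lim_null_comparison[OF always_eventually tendsto_norm_zero])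
  show "sup_norm x \<le> sup_norm y" if "y \<in> c0_space" "\<And>n. cmod (x n) \<le> cmod (y n)" for x y
    by (rule sup_norm_le) (rule order.trans[OF that(2) cmod_le_sup_norm[OF that(1)]])
  have finite_supp: "restr {m..<n} x \<in> c0_space" for m n x
    unfolding c0_space_def
    by (auto simp: restr_def eventually_sequentially intro!: tendsto_eventually exI[of _ n])
  have "unit_seq 0 = restr {0..<1} (\<lambda>n. 1)" by (auto simp: unit_seq_def restr_def)
  then show "unit_seq 0 \<in> c0_space" using finite_supp[of 0 1 "\<lambda>n. 1"] by (simp only:)
  show "right_shift x \<in> c0_space" if "x \<in> c0_space" for x
    using that unfolding c0_space_def by (subst mem_Collect_eq, subst filterlim_sequentially_Suc[symmetric]) simp
  show "sup_norm (right_shift x) \<le> sup_norm x" if x: "x \<in> c0_space" for x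
  proof (rule sup_norm_le)
    show "cmod (right_shift x n) \<le> sup_norm x" for n
      using cmod_le_sup_norm[OF x] order.trans[OF norm_ge_zero cmod_le_sup_norm[OF x, of 0]]
      by (cases n) auto
  qed
  show "\<exists>K\<ge>0. \<forall>x\<in>c0_space. cmod (x n) \<le> K * sup_norm x" for n
    using cmod_le_sup_norm by (intro exI[of _ 1]) auto
  show "(\<lambda>m. sup_norm (restr {m..} x)) \<longlonglongrightarrow> 0" if x: "x \<in> c0_space" for x
  proof (rule tendstoI)
    fix e :: real assume e: "e > 0"
    then obtain M where M: "\<And>n. n \<ge> M \<Longrightarrow> cmod (x n) < e/2"
      using LIMSEQ_D[of x 0 "e/2"] x by (auto simp: c0_space_def)
    have "\<bar>sup_norm (restr {m..} x)\<bar> < e" if "m \<ge> M" for m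
    proof -
      have b: "cmod (restr {m..} x n) \<le> e/2" for n
        using M[of n] that e by (auto simp: restr_def less_imp_le)
      have "0 \<le> sup_norm (restr {m..} x)"
        unfolding sup_norm_def
        by (rule cSUP_upper2[of _ _ 0]) (use b in \<open>auto intro!: bdd_aboveI[of _ "e/2"]\<close>)
      moreover have "sup_norm (restr {m..} x) \<le> e/2" by (rule sup_norm_le) (rule b)
      ultimately show ?thesis using e by simp
    qed
    then show "\<forall>\<^sub>F m in sequentially. dist (sup_norm (restr {m..} x)) 0 < e"
      by (auto simp: eventually_sequentially)
  qed
  show "x \<in> c0_space"
    if cau: "\<And>\<epsilon>. \<epsilon> > 0 \<Longrightarrow> \<exists>m. \<forall>n. sup_norm (restr {m..<n} x) \<le> \<epsilon>" for x
    unfolding c0_space_def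
  proof (intro CollectI LIMSEQ_I)
    fix e :: real assume "e > 0"
    then obtain m where m: "\<And>n. sup_norm (restr {m..<n} x) \<le> e/2" using cau[of "e/2"] by auto
    have "cmod (x n) < e" if "n \<ge> m" for n
      using cmod_le_sup_norm[OF finite_supp[of m "Suc n" x], of n] m[of "Suc n"] that \<open>e > 0\<close>
      by (simp add: restr_def)
    then show "\<exists>m. \<forall>n\<ge>m. norm (x n - 0) < e" by auto
  qed
qed

lemma harmonic_mem_c0: "(\<lambda>n. 1 / of_nat (Suc n)) \<in> c0_space"
  using tendsto_of_real[OF LIMSEQ_inverse_real_of_nat, where 'a = complex]
  by (simp add: c0_space_def inverse_eq_divide del: of_nat_Suc)

section \<open>The spaces ces and the main result\<close>

lemma shift_lattice_ces:
  assumes "p = 0 \<or> 1 < p"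
  shows "shift_lattice (ces p) (ces_norm p)"
proof (cases "p = 0")
  case True
  then show ?thesis
    using shift_lattice.shift_lattice_average[OF shift_lattice_c0 harmonic_mem_c0]
    by (simp add: ces_def ces_norm_def[abs_def] average_def[abs_def])
next
  case False
  then have "1 < p" using assms by simp
  then show ?thesis
    using shift_lattice.shift_lattice_average[OF shift_lattice_lp harmonic_mem_lp, of p] False
    by (simp add: ces_def ces_norm_def[abs_def] average_def[abs_def])
qed

theorem theorem4p6:
  fixes t p :: real
  assumes "0 \<le> t" and "t < 1"
    and "p = 0 \<or> 1 < p"
  shows "cesaro t \<in> cont_linear_ops (ces p) (ces_norm p) \<and>
    op_norm (ces p) (ces_norm p) (cesaro t) \<le> inverse (1 - t) \<and>
    compact_op (ces p) (ces_norm p) (cesaro t) \<and>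
    spectrum_op (ces p) (ces_norm p) (cesaro t) = Lam \<union> {0} \<and>
    point_spectrum (ces p) (cesaro t) = Lam \<and>
    continuous_spectrum (ces p) (ces_norm p) (cesaro t) = {0} \<and>
    residual_spectrum (ces p) (ces_norm p) (cesaro t) = {}"
proof -
  interpret shift_lattice "ces p" "ces_norm p"
    using assms(3) by (rule shift_lattice_ces)
  show ?thesis
    using cesaro_cont op_norm_cesaro compact_cesaro cesaro_spectra assms(1,2) by simp
qed

end
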